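(* Let $t\in(0,1)$ and $k\ge1$. The boundary $\partial\mathscr{G}^{(k)}_t$ (the set of extreme coherent systems) is in bijection with $\mathrm{Sig}_k$: under this bijection $\mu\in\mathrm{Sig}_k$ corresponds to the coherent system $(M^\mu_n)_{n\ge1}$ given by \[ M^\mu_n(\lambda)=Q_{-\lambda/-\mu}(t^n,t^{n+1},\dots)\frac{P_{-\lambda}(1,t,\dots,t^{k-1})}{P_{-\mu}(1,t,\dots,t^{k-1})\,\Pi(1,t,\dots,t^{k-1};t^n,t^{n+1},\dots)},\qquad\lambda\in\mathrm{Sig}_k . \]
   Context: $\mathrm{Sig}_k=\{\lambda\in\mathbb{Z}^k:\lambda_1\ge\dots\ge\lambda_k\}$; for $\lambda\in\mathrm{Sig}_k$, $-\lambda=(-\lambda_k,\dots,-\lambda_1)$, $|\lambda|=\sum\lambda_i$, $m_x(\lambda)=\#\{i:\lambda_i=x\}$. $(a;t)_m=\prod_{i=0}^{m-1}(1-at^i)$. $P_\lambda(x_1,\dots,x_k;t)=\frac{1}{v_\lambda(t)}\sum_{\sigma\in S_k}\sigma(x^\lambda\prod_{i<j}\frac{x_i-tx_j}{x_i-x_j})$ with $v_\lambda=\prod_x\frac{(t;t)_{m_x(\lambda)}}{(1-t)^{m_x(\lambda)}}$. Write $\alpha\prec_Q\beta$ ($\alpha,\beta\in\mathrm{Sig}_k$) if $\beta_i\ge\alpha_i$ ($i\le k$) and $\alpha_i\ge\beta_{i+1}$ ($i\le k-1$), with $\varphi_{\beta/\alpha}=\prod_{x:m_x(\beta)=m_x(\alpha)+1}(1-t^{m_x(\beta)})$;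 $Q_{\nu/\lambda}(y_1,\dots,y_J)=\sum\prod_{i=1}^Jy_i^{|\lambda^{(i)}|-|\lambda^{(i-1)}|}\varphi_{\lambda^{(i)}/\lambda^{(i-1)}}$ over chains $\lambda=\lambda^{(0)}\prec_Q\dots\prec_Q\lambda^{(J)}=\nu$; $Q_{\nu/\lambda}(t^n,t^{n+1},\dots)=\lim_{J\to\infty}Q_{\nu/\lambda}(t^n,\dots,t^{n+J-1})$. $\Pi(x_1,\dots,x_a;y_1,y_2,\dots)=\prod_{i,j}\frac{1-tx_iy_j}{1-x_iy_j}$. The graded graph $\mathscr{G}^{(k)}_t$ has levels $n\ge1$, each with vertex set $\mathrm{Sig}_k$, and cotransition probabilities from level $n+1$ to level $n$: $\tilde L^{n+1}_n(\nu,\lambda)=Q_{-\lambda/-\nu}(t^n)\frac{P_{-\lambda}(1,\dots,t^{k-1})}{P_{-\nu}(1,\dots,t^{k-1})\Pi(1,\dots,t^{k-1};t^n)}$. A coherent system is a sequence $(M_n)_{n\ge1}$ of probability measures on $\mathrm{Sig}_k$ with $\sum_\nu M_{n+1}(\nu)\tilde L^{n+1}_n(\nu,\lambda)=M_n(\lambda)$; it is extreme if it is not a nontrivial convex combination $sM'+(1-s)M''$, $s\in(0,1)$, of two other coherent systems. *)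

theory Defs
  imports "HOL-Probability.Probability" "HOL-Combinatorics.Permutations"
begin

text \<open>
  Signatures are weakly decreasing integer lists. All positions are 0-indexed: the part
  \<open>\<lambda>\<^sub>i\<close> is \<open>l ! (i - 1)\<close>, and the variable \<open>x\<^sub>i\<close> (resp. \<open>y\<^sub>j\<close>) is \<open>x (i - 1)\<close> (resp. \<open>y (j - 1)\<close>).
\<close>

definition Sig :: "nat \<Rightarrow> int list set" where
  "Sig k = {l. length l = k \<and> sorted_wrt (\<ge>) l}"

definition neg_sig :: "int list \<Rightarrow> int list" where
  "neg_sig l = rev (map uminus l)"

definition qpoch :: "real \<Rightarrow> real \<Rightarrow> nat \<Rightarrow> real" where
  "qpoch a t m = (\<Prod>i<m. 1 - a * t ^ i)"

text \<open>The values not occurring in \<open>l\<close> have multiplicity 0 and contribute the factor 1 to \<open>v\<close>.\<close>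

definition hl_v :: "real \<Rightarrow> int list \<Rightarrow> real" where
  "hl_v t l = (\<Prod>a\<in>set l. qpoch t t (count_list l a) / (1 - t) ^ count_list l a)"

text \<open>
  The Hall--Littlewood Laurent polynomial as a function of a point \<open>(x 0, \<dots>, x (k - 1))\<close>.
  The symmetrization is evaluated termwise, so this is the value of the Laurent polynomial
  at points whose coordinates are nonzero and pairwise distinct.
\<close>

definition hl_P :: "nat \<Rightarrow> real \<Rightarrow> int list \<Rightarrow> (nat \<Rightarrow> real) \<Rightarrow> real" where
  "hl_P k t l x =
     1 / hl_v t l *
     (\<Sum>\<sigma> | \<sigma> permutes {..<k}.
        (\<Prod>i<k. x (\<sigma> i) powi (l ! i)) *
        (\<Prod>(i, j) \<in> {(i, j). i < j \<and> j < k}.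
           (x (\<sigma> i) - t * x (\<sigma> j)) / (x (\<sigma> i) - x (\<sigma> j))))"

definition prec_Q :: "nat \<Rightarrow> int list \<Rightarrow> int list \<Rightarrow> bool" where
  "prec_Q k a b \<longleftrightarrow>
     a \<in> Sig k \<and> b \<in> Sig k \<and>
     (\<forall>i<k. b ! i \<ge> a ! i) \<and> (\<forall>i. Suc i < k \<longrightarrow> a ! i \<ge> b ! Suc i)"

definition hl_phi :: "real \<Rightarrow> int list \<Rightarrow> int list \<Rightarrow> real" where
  "hl_phi t b a =
     (\<Prod>c | count_list b c = count_list a c + 1. 1 - t ^ count_list b c)"

definition Q_chains :: "nat \<Rightarrow> nat \<Rightarrow> int list \<Rightarrow> int list \<Rightarrow> int list list set" where
  "Q_chains k J nu la =
     {c. length c = Suc J \<and> c ! 0 = la \<and> c ! J = nu \<and> set c \<subseteq> Sig k \<and>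
         (\<forall>i<J. prec_Q k (c ! i) (c ! Suc i))}"

text \<open>The sum defining \<open>Q\<^bsub>\<nu>/\<lambda>\<^esub>(y\<^sub>1, \<dots>, y\<^sub>J)\<close> is over a finite set.\<close>

lemma finite_Q_chains: "finite (Q_chains k J nu la)"
proof -
  define B where "B = {l :: int list. set l \<subseteq> (\<Union>i<k. {la ! i..nu ! i}) \<and> length l = k}"
  have "finite B"
    unfolding B_def by (rule finite_lists_length_eq) auto
  have "Q_chains k J nu la \<subseteq> {c. set c \<subseteq> B \<and> length c = Suc J}"
  proof
    fix c assume c: "c \<in> Q_chains k J nu la"
    have mono: "c ! p ! i \<le> c ! q ! i" if "p \<le> q" "q \<le> J" "i < k" for p q i
      using that
    proof (induction q rule: dec_induct)
      case (step q)
      have "c ! q ! i \<le> c ! Suc q ! i"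
        using c step.prems by (auto simp: Q_chains_def prec_Q_def)
      with step.IH step.prems show ?case
        by linarith
    qed simp
    have "l \<in> B" if l: "l \<in> set c" for l
    proof -
      obtain p where p: "p \<le> J" "l = c ! p"
        using l c by (auto simp: in_set_conv_nth Q_chains_def less_Suc_eq_le)
      have len: "length l = k"
        using l c by (auto simp: Q_chains_def Sig_def)
      have "l ! i \<in> {la ! i..nu ! i}" if "i < k" for i
        using mono[of 0 p i] mono[of p J i] that p c by (simp add: Q_chains_def)
      then show ?thesis
        using len by (fastforce simp: B_def in_set_conv_nth)
    qed
    then show "c \<in> {c. set c \<subseteq> B \<and> length c = Suc J}"
      using c by (auto simp: Q_chains_def)
  qed
  then show ?thesis
    using finite_lists_length_eq[OF \<open>finite B\<close>] finite_subset by blast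
qed

definition hl_Q :: "nat \<Rightarrow> real \<Rightarrow> int list \<Rightarrow> int list \<Rightarrow> nat \<Rightarrow> (nat \<Rightarrow> real) \<Rightarrow> real" where
  "hl_Q k t nu la J y =
     (\<Sum>c\<in>Q_chains k J nu la.
        \<Prod>i<J. y i powi (sum_list (c ! Suc i) - sum_list (c ! i)) * hl_phi t (c ! Suc i) (c ! i))"

definition hl_Q_inf :: "nat \<Rightarrow> real \<Rightarrow> int list \<Rightarrow> int list \<Rightarrow> (nat \<Rightarrow> real) \<Rightarrow> real" where
  "hl_Q_inf k t nu la y = lim (\<lambda>J. hl_Q k t nu la J y)"

definition Pi_fin :: "real \<Rightarrow> nat \<Rightarrow> (nat \<Rightarrow> real) \<Rightarrow> nat \<Rightarrow> (nat \<Rightarrow> real) \<Rightarrow> real" where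
  "Pi_fin t a x b y = (\<Prod>i<a. \<Prod>j<b. (1 - t * x i * y j) / (1 - x i * y j))"

definition Pi_inf :: "real \<Rightarrow> nat \<Rightarrow> (nat \<Rightarrow> real) \<Rightarrow> (nat \<Rightarrow> real) \<Rightarrow> real" where
  "Pi_inf t a x y = (\<Prod>i<a. \<Prod>j. (1 - t * x i * y j) / (1 - x i * y j))"

text \<open>\<open>cotrans k t n nu la\<close> is the cotransition probability from \<open>nu\<close> on level \<open>n + 1\<close>
  to \<open>la\<close> on level \<open>n\<close>.\<close>

definition cotrans :: "nat \<Rightarrow> real \<Rightarrow> nat \<Rightarrow> int list \<Rightarrow> int list \<Rightarrow> real" where
  "cotrans k t n nu la =
     hl_Q k t (neg_sig la) (neg_sig nu) 1 (\<lambda>_. t ^ n) *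
     (hl_P k t (neg_sig la) (\<lambda>i. t ^ i) /
      (hl_P k t (neg_sig nu) (\<lambda>i. t ^ i) * Pi_fin t k (\<lambda>i. t ^ i) 1 (\<lambda>_. t ^ n)))"

text \<open>
  A coherent system is indexed by the levels \<open>n \<ge> 1\<close>; as a function on all naturals it is
  extensional (undefined at 0), so that equality of systems is equality on the levels \<open>n \<ge> 1\<close>.
\<close>

definition coherent_systems :: "nat \<Rightarrow> real \<Rightarrow> (nat \<Rightarrow> int list pmf) set" where
  "coherent_systems k t =
     {M \<in> {1..} \<rightarrow>\<^sub>E {p. set_pmf p \<subseteq> Sig k}.
        \<forall>n\<ge>1. \<forall>la\<in>Sig k.
          ((\<lambda>nu. pmf (M (n + 1)) nu * cotrans k t n nu la) has_sum pmf (M n) la) (Sig k)}"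

definition boundary :: "nat \<Rightarrow> real \<Rightarrow> (nat \<Rightarrow> int list pmf) set" where
  "boundary k t =
     {M \<in> coherent_systems k t.
        \<not> (\<exists>s M' M''. 0 < s \<and> s < 1 \<and>
              M' \<in> coherent_systems k t \<and> M'' \<in> coherent_systems k t \<and> M' \<noteq> M \<and> M'' \<noteq> M \<and>
              (\<forall>n\<ge>1. \<forall>la\<in>Sig k. pmf (M n) la = s * pmf (M' n) la + (1 - s) * pmf (M'' n) la))}"

end

theory Submission
  imports Defs
begin

text \<open>
  From \<open>-\<lambda>\<close> to itself the cotransition kernel at level \<open>n\<close> has the weight
  \<open>(1 - t ^ n) / (1 - t ^ (n + k)) \<ge> 1 - t ^ n\<close>. The chain descending through the levels therefore
  moves only finitely often, so a coherent system is determined by the law of its state at level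
  infinity: coherent systems are the mixtures of the entrance laws started from a point mass at
  infinity, and the extreme ones are these entrance laws.

  The Hall--Littlewood input consists of two facts: the kernels are stochastic (the skew Cauchy
  identity), and they commute, which is needed because the chain applies the variable
  \<open>t ^ n\<close> last while \<open>Q\<close> lists it first. At the principal specialization all
  weights are explicit. Describing a signature \<open>a\<close> by the numbers of parts \<open>\<ge> x\<close>, a strip
  \<open>a \<prec>\<^sub>Q b\<close> becomes a set of unit-width edges between consecutive integers and its weight becomes a
  product over integer sites, so that both facts reduce to an invariant of a transfer recursion
  with two states, checked one site at a time.
\<close>

section \<open>Entrance laws of freezing kernels\<close>

text \<open>Why the weights become explicit in a usable form: at the principal point a value of
  \<open>hl_P\<close> is a constant times \<open>t powi nstat a / qpoch_mult t a\<close>. Ratios of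
  such values turn the coefficient phi of the Q-functions into the coefficient psi of the
  P-functions, which is \<open>hl_phi\<close> with its arguments exchanged. A factor of psi is
  \<open>1 - t ^ m\<close> with m a multiplicity in the smaller signature, so it vanishes when a
  part would have to leave an empty site. Edge sets that come from no strip thus get weight 0, and
  sums over strips become unconstrained sums over edge subsets; this is what a two-state recursion
  can evaluate. The obstacle on the probabilistic side is that the state space is infinite, so
  pointwise limits of laws might lose mass. All estimates are therefore uniform over test functions
  with values in the unit interval, that is, in total variation. Existence of the limit in
  \<open>hl_Q_inf\<close> is not presupposed either; it is deduced from convergence of the
  chain.\<close>

lemma pmf_of_has_sum:
  fixes f :: "'a \<Rightarrow> real"
  assumes nonneg: "\<And>x. x \<in> A \<Longrightarrow> 0 \<le> f x" and sum: "(f has_sum 1) A"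
  obtains p where "set_pmf p \<subseteq> A" and "\<And>x. x \<in> A \<Longrightarrow> pmf p x = f x"
proof -
  define g where "g x = (if x \<in> A then f x else 0)" for x
  have g0: "0 \<le> g x" for x
    by (simp add: g_def nonneg)
  have gs: "(g has_sum 1) UNIV"
    using sum by (subst has_sum_cong_neutral[where T = A and g = f]) (auto simp: g_def)
  have abs: "Infinite_Set_Sum.abs_summable_on g UNIV"
    using gs g0 by (simp add: abs_summable_equivalent[symmetric] has_sum_imp_summable)
  have "(\<integral>\<^sup>+x. g x \<partial>count_space UNIV) = ennreal (infsetsum g UNIV)"
    by (rule nn_integral_conv_infsetsum[OF abs]) (simp add: g0)
  also have "infsetsum g UNIV = 1"
    using infsetsum_infsum[OF abs] infsumI[OF gs] by simp
  finally have prob: "(\<integral>\<^sup>+x. g x \<partial>count_space UNIV) = 1"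
    by simp
  show thesis
  proof
    show "set_pmf (embed_pmf g) \<subseteq> A"
      using set_embed_pmf[of g, OF g0 prob] by (auto simp: g_def split: if_splits)
    show "pmf (embed_pmf g) x = f x" if "x \<in> A" for x
      using pmf_embed_pmf[of g, OF g0 prob] that by (simp add: g_def)
  qed
qed

lemma expectation_has_sum:
  fixes g :: "'a \<Rightarrow> real"
  assumes g: "\<And>x. \<bar>g x\<bar> \<le> C" and sub: "set_pmf p \<subseteq> A"
  shows "((\<lambda>x. pmf p x * g x) has_sum measure_pmf.expectation p g) A"
proof -
  have "integrable (measure_pmf p) g"
    by (rule measure_pmf.integrable_const_bound[where B = C]) (auto simp: g)
  then have abs: "Infinite_Set_Sum.abs_summable_on (\<lambda>x. pmf p x * g x) UNIV"
    unfolding abs_summable_on_def measure_pmf_eq_density by (simp add: integrable_density)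
  have "((\<lambda>x. pmf p x * g x) has_sum measure_pmf.expectation p g) UNIV"
    unfolding pmf_expectation_eq_infsetsum infsetsum_infsum[OF abs]
    by (rule has_sum_infsum[OF abs_summable_summable[OF abs[folded abs_summable_equivalent]]])
  then show ?thesis
    using sub by (subst has_sum_cong_neutral[where T = UNIV and g = "\<lambda>x. pmf p x * g x"])
      (auto simp: pmf_eq_0_set_pmf)
qed

lemma integrable_pmf_bounded:
  fixes g :: "'a \<Rightarrow> real"
  assumes "\<And>x. 0 \<le> g x" "\<And>x. g x \<le> 1"
  shows "integrable (measure_pmf p) g"
  by (rule measure_pmf.integrable_const_bound[where B = 1]) (use assms in auto)

lemma expectation_pmf_bounds:
  fixes g :: "'a \<Rightarrow> real"
  assumes "\<And>x. 0 \<le> g x" "\<And>x. g x \<le> 1"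
  shows "0 \<le> measure_pmf.expectation p g" "measure_pmf.expectation p g \<le> 1"
proof -
  show "0 \<le> measure_pmf.expectation p g"
    using assms by (intro integral_nonneg_AE) auto
  have "measure_pmf.expectation p g \<le> measure_pmf.expectation p (\<lambda>_. 1)"
    using assms by (intro integral_mono integrable_pmf_bounded) auto
  then show "measure_pmf.expectation p g \<le> 1"
    by simp
qed

lemma expectation_bind_pmf:
  fixes g :: "'b \<Rightarrow> real"
  assumes g: "\<And>x. 0 \<le> g x" "\<And>x. g x \<le> 1"
  shows "measure_pmf.expectation (bind_pmf p f) g
    = measure_pmf.expectation p (\<lambda>x. measure_pmf.expectation (f x) g)"
proof -
  note b = expectation_pmf_bounds[of g, OF g]
  have "ennreal (measure_pmf.expectation (bind_pmf p f) g) = (\<integral>\<^sup>+x. g x \<partial>bind_pmf p f)"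
    by (rule nn_integral_eq_integral[symmetric]) (auto intro: integrable_pmf_bounded g)
  also have "\<dots> = (\<integral>\<^sup>+x. (\<integral>\<^sup>+y. g y \<partial>f x) \<partial>p)"
    by simp
  also have "\<dots> = (\<integral>\<^sup>+x. measure_pmf.expectation (f x) g \<partial>p)"
    by (intro nn_integral_cong nn_integral_eq_integral) (auto intro: integrable_pmf_bounded g)
  also have "\<dots> = ennreal (measure_pmf.expectation p (\<lambda>x. measure_pmf.expectation (f x) g))"
    by (rule nn_integral_eq_integral) (auto intro: integrable_pmf_bounded b)
  finally show ?thesis
    using b expectation_pmf_bounds[of "\<lambda>x. measure_pmf.expectation (f x) g", OF b]
    by (metis ennreal_inj)
qed

lemma expectation_diff_le:
  fixes g h :: "'a \<Rightarrow> real"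
  assumes g: "\<And>x. 0 \<le> g x" "\<And>x. g x \<le> 1" and h: "\<And>x. 0 \<le> h x" "\<And>x. h x \<le> 1"
    and gh: "\<And>x. \<bar>g x - h x\<bar> \<le> e"
  shows "\<bar>measure_pmf.expectation p g - measure_pmf.expectation p h\<bar> \<le> e"
proof -
  have e: "e \<ge> 0"
    using order_trans[OF abs_ge_zero gh] .
  have i: "integrable (measure_pmf p) g" "integrable (measure_pmf p) h"
    by (auto intro: integrable_pmf_bounded g h)
  have "measure_pmf.expectation p (\<lambda>x. g x - h x) = measure_pmf.expectation p g - measure_pmf.expectation p h"
    using i by simp
  moreover have "\<bar>measure_pmf.expectation p (\<lambda>x. g x - h x)\<bar> \<le> measure_pmf.expectation p (\<lambda>_. e)"
    using i gh by (intro order_trans[OF integral_abs_bound] integral_mono) auto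
  ultimately show ?thesis
    by simp
qed

text \<open>\<open>1 - pmf p a\<close> is the total variation distance from \<open>p\<close> to the
  point mass at \<open>a\<close>; through this estimate a kernel with large holding probability is
  almost invisible to every test function.\<close>

lemma expectation_near_point:
  fixes g :: "'a \<Rightarrow> real"
  assumes g: "\<And>x. 0 \<le> g x" "\<And>x. g x \<le> 1"
  shows "\<bar>measure_pmf.expectation p g - g a\<bar> \<le> 1 - pmf p a"
proof -
  have i: "integrable (measure_pmf p) g"
    by (auto intro: integrable_pmf_bounded g)
  have "measure_pmf.expectation p g - g a = measure_pmf.expectation p (\<lambda>x. g x - g a)"
    using i by simp
  also have "\<bar>\<dots>\<bar> \<le> measure_pmf.expectation p (\<lambda>x. \<bar>g x - g a\<bar>)"
    by (rule integral_abs_bound)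
  also have "\<dots> \<le> measure_pmf.expectation p (\<lambda>x. 1 - indicator {a} x)"
  proof (rule integral_mono)
    show "integrable (measure_pmf p) (\<lambda>x. \<bar>g x - g a\<bar>)" using i by simp
    show "integrable (measure_pmf p) (\<lambda>x. 1 - indicator {a} x :: real)"
      by (rule integrable_pmf_bounded) (auto split: split_indicator)
    show "\<bar>g x - g a\<bar> \<le> 1 - indicator {a} x" for x
      using g[of x] g[of a] by (auto split: split_indicator simp: abs_if)
  qed
  also have "\<dots> = 1 - pmf p a"
    by (subst Bochner_Integration.integral_diff) (auto simp: measure_pmf_single intro!: integrable_pmf_bounded)
  finally show ?thesis .
qed

lemma pmf_one_imp_return:
  assumes "pmf p x = 1"
  shows "p = return_pmf x"
proof (rule pmf_eqI)
  fix y
  show "pmf p y = pmf (return_pmf x) y"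
    using expectation_near_point[of "indicator {y}" p x] assms
    by (auto simp: measure_pmf_single indicator_def split: if_splits)
qed

text \<open>Scheffe's argument: since the limit is itself a probability law, a finite set carries
  almost all of its mass, hence also almost all the mass of \<open>p n\<close> for large n, and on a
  finite set pointwise convergence suffices.\<close>

lemma expectation_tendsto:
  fixes g :: "'a \<Rightarrow> real"
  assumes lim: "\<And>x. (\<lambda>n. pmf (p n) x) \<longlonglongrightarrow> pmf q x"
    and g: "\<And>x. 0 \<le> g x" "\<And>x. g x \<le> 1"
  shows "(\<lambda>n. measure_pmf.expectation (p n) g) \<longlonglongrightarrow> measure_pmf.expectation q g"
proof (rule LIMSEQ_I)
  fix r :: real assume r: "0 < r"
  have one: "((\<lambda>x. pmf q x) has_sum 1) UNIV"
    using expectation_has_sum[of "\<lambda>_. 1" 1 q UNIV] by simp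
  obtain B where B: "finite B" "1 - r / 3 < sum (pmf q) B"
  proof -
    have "\<forall>\<^sub>F B in finite_subsets_at_top UNIV. 1 - r / 3 < sum (pmf q) B"
      using one r unfolding has_sum_def by (intro order_tendstoD) auto
    then show thesis
      using that unfolding eventually_finite_subsets_at_top by blast
  qed
  have split: "\<bar>measure_pmf.expectation m g - (\<Sum>x\<in>B. pmf m x * g x)\<bar> \<le> 1 - sum (pmf m) B" for m :: "'a pmf"
  proof -
    have i: "integrable (measure_pmf m) (\<lambda>x. g x * indicator B x)"
      by (rule integrable_pmf_bounded) (use g in \<open>auto split: split_indicator\<close>)
    have i2: "integrable (measure_pmf m) (\<lambda>x. indicator B x :: real)"
      by (rule integrable_pmf_bounded) (auto split: split_indicator)
    have ig: "integrable (measure_pmf m) g"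
      by (auto intro: integrable_pmf_bounded g)
    have eq: "(\<Sum>x\<in>B. pmf m x * g x) = measure_pmf.expectation m (\<lambda>x. g x * indicator B x)"
      using B(1) by (subst integral_measure_pmf_real[of B]) (auto simp: mult.commute intro!: sum.cong simp: indicator_def split: if_splits)
    have eq2: "sum (pmf m) B = measure_pmf.expectation m (indicator B)"
      using B(1) by (simp add: measure_measure_pmf_finite)
    have "measure_pmf.expectation m g - measure_pmf.expectation m (\<lambda>x. g x * indicator B x)
       = measure_pmf.expectation m (\<lambda>x. g x - g x * indicator B x)"
      using i ig by simp
    also have "\<bar>\<dots>\<bar> \<le> measure_pmf.expectation m (\<lambda>x. \<bar>g x - g x * indicator B x\<bar>)"
      by (rule integral_abs_bound)
    also have "\<dots> \<le> measure_pmf.expectation m (\<lambda>x. 1 - indicator B x)"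
      using i ig i2 g by (intro integral_mono) (auto split: split_indicator)
    also have "\<dots> = 1 - measure_pmf.expectation m (indicator B)"
      using i2 by simp
    finally show ?thesis
      unfolding eq eq2 .
  qed
  have l1: "(\<lambda>n. sum (pmf (p n)) B) \<longlonglongrightarrow> sum (pmf q) B"
    by (intro tendsto_sum lim)
  have l2: "(\<lambda>n. \<Sum>x\<in>B. pmf (p n) x * g x) \<longlonglongrightarrow> (\<Sum>x\<in>B. pmf q x * g x)"
    by (intro tendsto_intros lim)
  have "\<forall>\<^sub>F n in sequentially. 1 - r / 3 < sum (pmf (p n)) B"
    using order_tendstoD(1)[OF l1 B(2)] .
  moreover have "\<forall>\<^sub>F n in sequentially. \<bar>(\<Sum>x\<in>B. pmf (p n) x * g x) - (\<Sum>x\<in>B. pmf q x * g x)\<bar> < r / 3"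
    using tendstoD[OF l2, of "r / 3"] r by (simp add: dist_real_def)
  ultimately have "\<forall>\<^sub>F n in sequentially. \<bar>measure_pmf.expectation (p n) g - measure_pmf.expectation q g\<bar> < r"
  proof eventually_elim
    case (elim n)
    show ?case
      using elim split[of "p n"] split[of q] B(2) by linarith
  qed
  then show "\<exists>no. \<forall>n\<ge>no. norm (measure_pmf.expectation (p n) g - measure_pmf.expectation q g) < r"
    by (simp add: eventually_sequentially)
qed

text \<open>Pointwise limits exist by completeness, but their sum might be less than 1. Applying the
  uniform bound to the indicator of a finite set that carries most of one fixed \<open>p N\<close>
  shows that no mass escapes.\<close>

lemma pmf_Cauchy_limit:
  fixes p :: "nat \<Rightarrow> 'a pmf" and \<tau> :: "nat \<Rightarrow> real"
  assumes tau: "\<tau> \<longlonglongrightarrow> 0"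
    and close: "\<And>n m g. \<lbrakk>n \<le> m; \<And>x. 0 \<le> g x; \<And>x. g x \<le> 1\<rbrakk> \<Longrightarrow>
      \<bar>measure_pmf.expectation (p m) g - measure_pmf.expectation (p n) g\<bar> \<le> \<tau> n"
  shows "\<exists>q. \<forall>x. (\<lambda>n. pmf (p n) x) \<longlonglongrightarrow> pmf q x"
proof -
  have conv: "convergent (\<lambda>n. pmf (p n) x)" for x
  proof (rule Cauchy_convergent, rule metric_CauchyI)
    fix e :: real assume "0 < e"
    then obtain N where N: "\<tau> N < e / 2"
      using order_tendstoD(2)[OF tau, of "e / 2"] by (auto simp: eventually_sequentially)
    have c: "\<bar>pmf (p m) x - pmf (p N) x\<bar> \<le> \<tau> N" if "N \<le> m" for m
      using close[OF that, of "indicator {x}"] by (simp add: measure_pmf_single split: split_indicator)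
    show "\<exists>M. \<forall>m\<ge>M. \<forall>n\<ge>M. dist (pmf (p m) x) (pmf (p n) x) < e"
    proof (intro exI[of _ N] allI impI)
      fix m n assume "N \<le> m" "N \<le> n"
      then show "dist (pmf (p m) x) (pmf (p n) x) < e"
        using c[of m] c[of n] N by (auto simp: dist_real_def)
    qed
  qed
  define f where "f x = lim (\<lambda>n. pmf (p n) x)" for x
  have lim: "(\<lambda>n. pmf (p n) x) \<longlonglongrightarrow> f x" for x
    using conv[of x] by (simp add: f_def convergent_LIMSEQ_iff)
  have f0: "0 \<le> f x" for x
    by (rule LIMSEQ_le_const[OF lim]) auto
  have limsum: "(\<lambda>n. sum (pmf (p n)) B) \<longlonglongrightarrow> sum f B" for B
    by (intro tendsto_sum lim)
  have le1: "sum f B \<le> 1" if "finite B" for B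
    using that by (intro LIMSEQ_le_const2[OF limsum])
      (auto simp: measure_measure_pmf_finite[symmetric] measure_pmf.prob_le_1)
  have summ: "f summable_on UNIV"
    by (rule nonneg_bdd_above_summable_on) (auto simp: f0 bdd_above_def intro!: exI[of _ 1] le1)
  have "infsum f UNIV \<le> 1"
    by (rule infsum_le_finite_sums[OF summ]) (auto intro: le1)
  moreover have "1 \<le> infsum f UNIV"
  proof (rule field_le_epsilon)
    fix e :: real assume e: "0 < e"
    then obtain N where N: "\<tau> N < e / 2"
      using order_tendstoD(2)[OF tau, of "e / 2"] by (auto simp: eventually_sequentially)
    have one: "((\<lambda>x. pmf (p N) x) has_sum 1) UNIV"
      using expectation_has_sum[of "\<lambda>_. 1" 1 "p N" UNIV] by simp
    have "\<forall>\<^sub>F B in finite_subsets_at_top UNIV. 1 - e / 2 < sum (pmf (p N)) B"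
      using one e unfolding has_sum_def by (intro order_tendstoD) auto
    then obtain B where B: "finite B" "1 - e / 2 < sum (pmf (p N)) B"
      unfolding eventually_finite_subsets_at_top by blast
    have "1 - e \<le> sum (pmf (p m)) B" if "N \<le> m" for m
      using close[OF that, of "indicator B"] B N
      by (simp add: measure_measure_pmf_finite abs_le_iff split: split_indicator)
    then have "1 - e \<le> sum f B"
      by (intro LIMSEQ_le_const[OF limsum]) auto
    also have "\<dots> \<le> infsum f UNIV"
      using B(1) f0 summ by (intro finite_sum_le_infsum) auto
    finally show "1 \<le> infsum f UNIV + e"
      by simp
  qed
  ultimately have "infsum f UNIV = 1"
    by simp
  then have "(f has_sum 1) UNIV"
    using summ by (metis has_sum_infsum)
  from pmf_of_has_sum[OF f0 this] obtain q where "\<forall>x. pmf q x = f x"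
    by auto
  then show ?thesis
    using lim by (intro exI[of _ q]) simp
qed

text \<open>\<open>\<tau> n\<close> dominates the total probability of moving at any level from n
  upwards. Bounding each level by a decrement of \<open>\<tau>\<close> lets the errors
  telescope.\<close>

locale freezing_kernels =
  fixes L :: "nat \<Rightarrow> 'a \<Rightarrow> 'a pmf" and \<tau> :: "nat \<Rightarrow> real"
  assumes stay: "1 - pmf (L n x) x \<le> \<tau> n - \<tau> (Suc n)"
    and tau_lim: "\<tau> \<longlonglongrightarrow> 0"
begin

lemma tau_antimono: "n \<le> m \<Longrightarrow> \<tau> m \<le> \<tau> n"
proof (induction m rule: dec_induct)
  case (step m)
  have "\<tau> (Suc m) \<le> \<tau> m"
    using stay[of m undefined] pmf_le_1[of "L m undefined" undefined] by linarith
  with step.IH show ?case by simp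
qed simp

lemma tau_nonneg: "0 \<le> \<tau> n"
  by (rule LIMSEQ_le_const2[OF tau_lim]) (use tau_antimono in blast)

text \<open>The law at level n of the chain started from x at level \<open>n + J\<close>. The
  recursion removes the highest level, so that increasing J inserts one near-identity step at the
  start; \<open>descend_Suc\<close> removes the lowest level instead.\<close>

fun descend :: "nat \<Rightarrow> nat \<Rightarrow> 'a \<Rightarrow> 'a pmf" where
  "descend n 0 x = return_pmf x"
| "descend n (Suc J) x = bind_pmf (L (n + J) x) (descend n J)"

lemma descend_0: "descend n 0 = return_pmf"
  by (rule ext) simp

lemma descend_Suc: "descend n (Suc J) x = bind_pmf (descend (Suc n) J x) (L n)"
proof (induction J arbitrary: x)
  case 0
  then show ?case by (simp add: descend_0 bind_return_pmf bind_return_pmf')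
next
  case (Suc J)
  have "descend n (Suc (Suc J)) x = bind_pmf (L (n + Suc J) x) (descend n (Suc J))"
    by simp
  also have "\<dots> = bind_pmf (L (Suc n + J) x) (\<lambda>z. bind_pmf (descend (Suc n) J z) (L n))"
    using Suc.IH by (intro bind_pmf_cong refl) auto
  also have "\<dots> = bind_pmf (descend (Suc n) (Suc J) x) (L n)"
    by (simp add: bind_assoc_pmf)
  finally show ?case .
qed

text \<open>Each additional level on top contributes one initial step, which leaves x with
  probability at most one decrement of \<open>\<tau>\<close>. The bound is uniform in x, so it
  survives averaging over starting points.\<close>

lemma descend_close:
  assumes "J \<le> J'" and g: "\<And>x. 0 \<le> g x" "\<And>x. g x \<le> 1"
  shows "\<bar>measure_pmf.expectation (descend n J' x) g - measure_pmf.expectation (descend n J x) g\<bar>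
    \<le> \<tau> (n + J) - \<tau> (n + J')"
  using assms(1)
proof (induction J' rule: dec_induct)
  case (step J')
  have "\<bar>measure_pmf.expectation (descend n (Suc J') x) g - measure_pmf.expectation (descend n J' x) g\<bar>
     \<le> 1 - pmf (L (n + J') x) x"
    using expectation_near_point[of "\<lambda>z. measure_pmf.expectation (descend n J' z) g" "L (n + J') x" x]
      expectation_pmf_bounds[of g, OF g] expectation_bind_pmf[of g "L (n + J') x" "descend n J'", OF g]
    by simp
  also have "\<dots> \<le> \<tau> (n + J') - \<tau> (n + Suc J')"
    using stay[of "n + J'" x] by simp
  finally show ?case
    using step.IH by linarith
qed simp

lemma descend_limit: "\<exists>q. \<forall>y. (\<lambda>J. pmf (descend n J x) y) \<longlonglongrightarrow> pmf q y"
proof (rule pmf_Cauchy_limit[of "\<lambda>J. \<tau> (n + J)"])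
  show "(\<lambda>J. \<tau> (n + J)) \<longlonglongrightarrow> 0"
    using LIMSEQ_ignore_initial_segment[OF tau_lim, of n] by (simp add: add.commute)
next
  fix J J' :: nat and g :: "'a \<Rightarrow> real" assume "J \<le> J'" "\<And>x. 0 \<le> g x" "\<And>x. g x \<le> 1"
  from descend_close[of J J' g n x, OF this] tau_nonneg[of "n + J'"]
  show "\<bar>measure_pmf.expectation (descend n J' x) g - measure_pmf.expectation (descend n J x) g\<bar> \<le> \<tau> (n + J)"
    by linarith
qed

text \<open>The law at level n of the chain started from x at level infinity;
  \<open>descend_limit\<close> justifies the choice.\<close>

definition entrance :: "'a \<Rightarrow> nat \<Rightarrow> 'a pmf" where
  "entrance x n = (SOME q. \<forall>y. (\<lambda>J. pmf (descend n J x) y) \<longlonglongrightarrow> pmf q y)"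

lemma descend_tendsto: "(\<lambda>J. pmf (descend n J x) y) \<longlonglongrightarrow> pmf (entrance x n) y"
  using someI_ex[OF descend_limit[of n x]] unfolding entrance_def by blast

text \<open>For J = 0 the comparison is with the point mass at x: high levels remember the starting
  point, uniformly in x.\<close>

lemma entrance_close: "\<bar>pmf (entrance x n) y - pmf (descend n J x) y\<bar> \<le> \<tau> (n + J)"
proof (rule LIMSEQ_le_const2)
  show "(\<lambda>J'. \<bar>pmf (descend n J' x) y - pmf (descend n J x) y\<bar>)
      \<longlonglongrightarrow> \<bar>pmf (entrance x n) y - pmf (descend n J x) y\<bar>"
    by (intro tendsto_intros descend_tendsto)
  show "\<exists>N. \<forall>J'\<ge>N. \<bar>pmf (descend n J' x) y - pmf (descend n J x) y\<bar> \<le> \<tau> (n + J)"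
  proof (intro exI[of _ J] allI impI)
    fix J' assume "J \<le> J'"
    from descend_close[OF this, of "indicator {y}" n x] tau_nonneg[of "n + J'"]
    show "\<bar>pmf (descend n J' x) y - pmf (descend n J x) y\<bar> \<le> \<tau> (n + J)"
      by (simp add: measure_pmf_single split: split_indicator)
  qed
qed

definition coherent :: "(nat \<Rightarrow> 'a pmf) \<Rightarrow> bool" where
  "coherent M \<longleftrightarrow> (\<forall>n\<ge>1. M n = bind_pmf (M (Suc n)) (L n))"

lemma entrance_step: "entrance x n = bind_pmf (entrance x (Suc n)) (L n)"
proof (rule pmf_eqI)
  fix y
  have "(\<lambda>J. pmf (descend n (Suc J) x) y) \<longlonglongrightarrow> pmf (bind_pmf (entrance x (Suc n)) (L n)) y"
    unfolding descend_Suc pmf_bind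
    by (rule expectation_tendsto) (auto simp: descend_tendsto pmf_le_1)
  moreover have "(\<lambda>J. pmf (descend n (Suc J) x) y) \<longlonglongrightarrow> pmf (entrance x n) y"
    by (rule LIMSEQ_Suc[OF descend_tendsto])
  ultimately show "pmf (entrance x n) y = pmf (bind_pmf (entrance x (Suc n)) (L n)) y"
    using LIMSEQ_unique by blast
qed

lemma coherent_mixture: "coherent (\<lambda>n. bind_pmf c (\<lambda>x. entrance x n))"
proof -
  have "bind_pmf c (\<lambda>x. entrance x n) = bind_pmf c (\<lambda>x. bind_pmf (entrance x (Suc n)) (L n))" for n
    by (rule bind_pmf_cong[OF refl]) (rule entrance_step)
  then show ?thesis
    unfolding coherent_def bind_assoc_pmf by blast
qed

text \<open>Every component is within \<open>\<tau> n\<close> of its starting point, so the mixing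
  law reappears as the limit over the levels. This makes it unique and lets affine relations between
  coherent systems pass to mixing laws.\<close>

lemma mixture_tendsto: "(\<lambda>n. pmf (bind_pmf c (\<lambda>x. entrance x n)) y) \<longlonglongrightarrow> pmf c y"
proof (rule Lim_null_comparison[THEN LIM_zero_cancel])
  show "\<forall>\<^sub>F n in sequentially. norm (pmf (bind_pmf c (\<lambda>x. entrance x n)) y - pmf c y) \<le> \<tau> n"
  proof (intro always_eventually allI)
    fix n
    have "\<bar>measure_pmf.expectation c (\<lambda>x. pmf (entrance x n) y)
        - measure_pmf.expectation c (\<lambda>x. indicator {y} x)\<bar> \<le> \<tau> n"
    proof (rule expectation_diff_le)
      fix x
      show "\<bar>pmf (entrance x n) y - indicator {y} x\<bar> \<le> \<tau> n"
        using entrance_close[of x n y 0] by (auto simp: indicator_def)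
    qed (auto simp: pmf_le_1 split: split_indicator)
    then show "norm (pmf (bind_pmf c (\<lambda>x. entrance x n)) y - pmf c y) \<le> \<tau> n"
      by (simp add: pmf_bind measure_pmf_single)
  qed
qed (rule tau_lim)

lemma coherent_descend:
  assumes "coherent M" "n \<ge> 1"
  shows "M n = bind_pmf (M (n + J)) (descend n J)"
proof (induction J)
  case 0
  then show ?case by (simp add: descend_0 bind_return_pmf')
next
  case (Suc J)
  have "M (n + J) = bind_pmf (M (n + Suc J)) (L (n + J))"
    using assms(1) assms(2) unfolding coherent_def add_Suc_right by (meson trans_le_add1)
  then show ?case
    by (subst Suc.IH) (auto simp: bind_assoc_pmf intro!: bind_pmf_cong)
qed

text \<open>The laws \<open>M n\<close> form a Cauchy sequence in total variation, with limit
  \<open>c\<close>. In the identity expressing \<open>M n\<close> through \<open>M (n + J)\<close>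
  and \<open>descend n J\<close>, the kernel may then be replaced by the entrance law and
  \<open>M (n + J)\<close> by \<open>c\<close> as J grows.\<close>

theorem coherent_is_mixture:
  assumes M: "coherent M"
  obtains c where "\<And>n. n \<ge> 1 \<Longrightarrow> M n = bind_pmf c (\<lambda>x. entrance x n)"
    and "\<And>y. (\<lambda>n. pmf (M n) y) \<longlonglongrightarrow> pmf c y"
proof -
  \<comment> \<open>The levels are shifted by one because coherence is required from level 1 on
    only.\<close>
  have close: "\<bar>measure_pmf.expectation (M (Suc m)) g - measure_pmf.expectation (M (Suc n)) g\<bar> \<le> \<tau> (Suc n)"
    if "n \<le> m" and g: "\<And>x. 0 \<le> g x" "\<And>x. g x \<le> 1" for n m and g :: "'a \<Rightarrow> real"
  proof -
    define J where "J = m - n"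
    have m: "Suc m = Suc n + J"
      using that by (simp add: J_def)
    note b = expectation_pmf_bounds[of g, OF g]
    have "\<bar>measure_pmf.expectation (M (Suc n + J)) (\<lambda>x. measure_pmf.expectation (descend (Suc n) J x) g)
        - measure_pmf.expectation (M (Suc n + J)) g\<bar> \<le> \<tau> (Suc n)"
    proof (rule expectation_diff_le[OF b g])
      fix x
      show "\<bar>measure_pmf.expectation (descend (Suc n) J x) g - g x\<bar> \<le> \<tau> (Suc n)"
        using descend_close[of 0 J g "Suc n" x, OF _ g] tau_nonneg[of "Suc n + J"] by simp
    qed
    then show ?thesis
      using coherent_descend[OF M, of "Suc n" J]
      by (simp add: m expectation_bind_pmf[of g, OF g] abs_minus_commute)
  qed
  have "\<exists>c. \<forall>y. (\<lambda>n. pmf (M (Suc n)) y) \<longlonglongrightarrow> pmf c y"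
    by (rule pmf_Cauchy_limit[OF LIMSEQ_Suc[OF tau_lim]]) (rule close)
  then obtain c where "\<And>y. (\<lambda>n. pmf (M (Suc n)) y) \<longlonglongrightarrow> pmf c y"
    by blast
  then have c: "(\<lambda>n. pmf (M n) y) \<longlonglongrightarrow> pmf c y" for y
    by (simp add: LIMSEQ_imp_Suc)
  show thesis
  proof
    fix n :: nat assume n: "n \<ge> 1"
    show "M n = bind_pmf c (\<lambda>x. entrance x n)"
    proof (rule pmf_eqI)
      fix y
      have "(\<lambda>J. measure_pmf.expectation (M (n + J)) (\<lambda>x. pmf (entrance x n) y))
          \<longlonglongrightarrow> measure_pmf.expectation c (\<lambda>x. pmf (entrance x n) y)"
        by (rule expectation_tendsto)
          (use LIMSEQ_ignore_initial_segment[OF c, of n] in \<open>auto simp: pmf_le_1 add.commute\<close>)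
      moreover have "(\<lambda>J. pmf (M n) y - measure_pmf.expectation (M (n + J)) (\<lambda>x. pmf (entrance x n) y)) \<longlonglongrightarrow> 0"
      proof (rule Lim_null_comparison)
        show "\<forall>\<^sub>F J in sequentially. norm (pmf (M n) y
          - measure_pmf.expectation (M (n + J)) (\<lambda>x. pmf (entrance x n) y)) \<le> \<tau> (n + J)"
        proof (intro always_eventually allI)
          fix J
          have "\<bar>measure_pmf.expectation (M (n + J)) (\<lambda>x. pmf (descend n J x) y)
            - measure_pmf.expectation (M (n + J)) (\<lambda>x. pmf (entrance x n) y)\<bar> \<le> \<tau> (n + J)"
            by (rule expectation_diff_le) (use entrance_close in \<open>auto simp: pmf_le_1 abs_minus_commute\<close>)
          then show "norm (pmf (M n) y
            - measure_pmf.expectation (M (n + J)) (\<lambda>x. pmf (entrance x n) y)) \<le> \<tau> (n + J)"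
            using arg_cong[OF coherent_descend[OF M n, of J], of "\<lambda>p. pmf p y"] by (simp add: pmf_bind)
        qed
        show "(\<lambda>J. \<tau> (n + J)) \<longlonglongrightarrow> 0"
          using LIMSEQ_ignore_initial_segment[OF tau_lim, of n] by (simp add: add.commute)
      qed
      ultimately have "(\<lambda>J. pmf (M n) y) \<longlonglongrightarrow> measure_pmf.expectation c (\<lambda>x. pmf (entrance x n) y)"
        using tendsto_add by fastforce
      then show "pmf (M n) y = pmf (bind_pmf c (\<lambda>x. entrance x n)) y"
        by (simp add: pmf_bind LIMSEQ_const_iff)
    qed
  qed (rule c)
qed

section \<open>Coherent systems as a simplex and its extreme points\<close>

definition systems :: "'a set \<Rightarrow> (nat \<Rightarrow> 'a pmf) set" where
  "systems S = {M \<in> {1..} \<rightarrow>\<^sub>E {p. set_pmf p \<subseteq> S}. coherent M}"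

definition mix :: "'a pmf \<Rightarrow> nat \<Rightarrow> 'a pmf" where
  "mix c = restrict (\<lambda>n. bind_pmf c (\<lambda>x. entrance x n)) {1..}"

lemma set_pmf_entrance:
  assumes S: "\<And>n x. x \<in> S \<Longrightarrow> set_pmf (L n x) \<subseteq> S" and x: "x \<in> S"
  shows "set_pmf (entrance x n) \<subseteq> S"
proof
  fix y assume y: "y \<in> set_pmf (entrance x n)"
  show "y \<in> S"
  proof (rule ccontr)
    assume yS: "y \<notin> S"
    have "set_pmf (descend n J x) \<subseteq> S" for J
      using x by (induction J arbitrary: x) (use S in fastforce)+
    then have "pmf (descend n J x) y = 0" for J
      using yS by (auto simp: pmf_eq_0_set_pmf)
    then show False
      using descend_tendsto[of n x y] y by (simp add: LIMSEQ_const_iff set_pmf_iff)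
  qed
qed

lemma mix_in_systems:
  assumes S: "\<And>n x. x \<in> S \<Longrightarrow> set_pmf (L n x) \<subseteq> S" and c: "set_pmf c \<subseteq> S"
  shows "mix c \<in> systems S"
proof -
  have "set_pmf (bind_pmf c (\<lambda>x. entrance x n)) \<subseteq> S" for n
    using set_pmf_entrance[OF S] c by (auto simp: set_bind_pmf)
  moreover have "coherent (mix c)"
    unfolding coherent_def
  proof (intro allI impI)
    fix n :: nat assume n: "1 \<le> n"
    have "mix c n = bind_pmf c (\<lambda>x. entrance x n)"
      using n by (simp add: mix_def)
    also have "\<dots> = bind_pmf (bind_pmf c (\<lambda>x. entrance x (Suc n))) (L n)"
      using coherent_mixture[unfolded coherent_def, rule_format, OF n] .
    also have "bind_pmf c (\<lambda>x. entrance x (Suc n)) = mix c (Suc n)"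
      by (simp add: mix_def)
    finally show "mix c n = bind_pmf (mix c (Suc n)) (L n)" .
  qed
  ultimately show ?thesis
    by (auto simp: systems_def mix_def)
qed

lemma mix_tendsto: "(\<lambda>n. pmf (mix c n) y) \<longlonglongrightarrow> pmf c y"
proof (rule Lim_transform_eventually[OF mixture_tendsto])
  show "\<forall>\<^sub>F n in sequentially. pmf (bind_pmf c (\<lambda>x. entrance x n)) y = pmf (mix c n) y"
    using eventually_ge_at_top[of 1] by eventually_elim (simp add: mix_def)
qed

lemma systems_obtain_mix:
  assumes "M \<in> systems S"
  obtains c where "set_pmf c \<subseteq> S" "M = mix c"
proof -
  have M: "M \<in> {1..} \<rightarrow>\<^sub>E {p. set_pmf p \<subseteq> S}" "coherent M"
    using assms by (auto simp: systems_def)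
  from coherent_is_mixture[OF M(2)] obtain c where c: "\<And>n. n \<ge> 1 \<Longrightarrow> M n = bind_pmf c (\<lambda>x. entrance x n)"
    and lim: "\<And>y. (\<lambda>n. pmf (M n) y) \<longlonglongrightarrow> pmf c y"
    by blast
  show thesis
  proof
    show "set_pmf c \<subseteq> S"
    proof
      fix y assume y: "y \<in> set_pmf c"
      show "y \<in> S"
      proof (rule ccontr)
        assume "y \<notin> S"
        then have "\<forall>n\<ge>1. pmf (M n) y = 0"
          using M(1) by (auto simp: pmf_eq_0_set_pmf PiE_def Pi_def)
        then have "\<forall>\<^sub>F n in sequentially. pmf (M n) y = 0"
          unfolding eventually_sequentially by blast
        then have "(\<lambda>n. pmf (M n) y) \<longlonglongrightarrow> 0"
          by (rule tendsto_eventually)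
        with lim[of y] y show False
          by (auto dest: LIMSEQ_unique simp: set_pmf_iff)
      qed
    qed
    show "M = mix c"
    proof
      fix n
      show "M n = mix c n"
        using M(1) c[of n] by (cases "n \<ge> 1") (auto simp: mix_def PiE_def extensional_def)
    qed
  qed
qed

lemma mix_eq_iff: "mix c = mix c' \<longleftrightarrow> c = c'"
proof
  assume eq: "mix c = mix c'"
  show "c = c'"
    by (rule pmf_eqI) (rule LIMSEQ_unique[OF mix_tendsto mix_tendsto[of c', folded eq]])
qed simp

lemma mix_convex_combination:
  assumes "\<And>n. n \<ge> 1 \<Longrightarrow> pmf (mix c n) y = s * pmf (mix c' n) y + (1 - s) * pmf (mix c'' n) y"
  shows "pmf c y = s * pmf c' y + (1 - s) * pmf c'' y"
proof (rule LIMSEQ_unique)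
  show "(\<lambda>n. pmf (mix c n) y) \<longlonglongrightarrow> pmf c y"
    by (rule mix_tendsto)
  have "(\<lambda>n. s * pmf (mix c' n) y + (1 - s) * pmf (mix c'' n) y) \<longlonglongrightarrow> s * pmf c' y + (1 - s) * pmf c'' y"
    by (intro tendsto_intros mix_tendsto)
  then show "(\<lambda>n. pmf (mix c n) y) \<longlonglongrightarrow> s * pmf c' y + (1 - s) * pmf c'' y"
    by (rule Lim_transform_eventually)
      (use assms in \<open>auto simp: eventually_sequentially intro!: exI[of _ 1]\<close>)
qed

text \<open>Conditioning on whether the atom x is hit writes a law as a convex combination of a
  point mass and a law avoiding x. This is the decomposition that refutes extremality of a
  nondegenerate mixture.\<close>

lemma pmf_bind_split_atom:
  fixes c :: "'b pmf"
  assumes "pmf c x < 1"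
  defines "c' \<equiv> cond_pmf c (- {x})"
  shows "pmf (bind_pmf c f) y = pmf c x * pmf (f x) y + (1 - pmf c x) * pmf (bind_pmf c' f) y"
    and "set_pmf c' = set_pmf c - {x}"
proof -
  have compl: "measure_pmf.prob c (- {x}) = 1 - pmf c x"
    using measure_pmf.prob_compl[of "{x}" c] by (simp add: measure_pmf_single Compl_eq_Diff_UNIV)
  have ne: "set_pmf c \<inter> - {x} \<noteq> {}"
    using compl assms(1) measure_pmf_zero_iff[of c "- {x}"] by simp
  have split: "c = bind_pmf (bernoulli_pmf (pmf c x)) (\<lambda>b. if b then return_pmf x else c')"
    by (rule pmf_eqI)
      (use assms(1) in \<open>auto simp: pmf_bind pmf_le_1 c'_def pmf_cond[OF ne] compl indicator_def\<close>)
  show "pmf (bind_pmf c f) y = pmf c x * pmf (f x) y + (1 - pmf c x) * pmf (bind_pmf c' f) y"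
    by (subst split, subst bind_assoc_pmf, subst pmf_bind) (simp add: pmf_le_1 bind_return_pmf)
  show "set_pmf c' = set_pmf c - {x}"
    unfolding c'_def by (subst set_cond_pmf[OF ne]) auto
qed

definition extreme_systems :: "'a set \<Rightarrow> (nat \<Rightarrow> 'a pmf) set" where
  "extreme_systems S = {M \<in> systems S.
     \<not> (\<exists>s M' M''. 0 < s \<and> s < 1 \<and> M' \<in> systems S \<and> M'' \<in> systems S \<and> M' \<noteq> M \<and> M'' \<noteq> M \<and>
           (\<forall>n\<ge>1. \<forall>y\<in>S. pmf (M n) y = s * pmf (M' n) y + (1 - s) * pmf (M'' n) y))}"

text \<open>A convex combination of numbers at most 1 equals 1 only if all of them are 1; this is
  applied to the masses that the mixing laws give to x.\<close>

lemma mix_return_extreme: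
  assumes S: "\<And>n x. x \<in> S \<Longrightarrow> set_pmf (L n x) \<subseteq> S" and x: "x \<in> S"
  shows "mix (return_pmf x) \<in> extreme_systems S"
proof -
  have False if s: "0 < s" "s < 1" and "M' \<in> systems S" "M'' \<in> systems S" and ne: "M' \<noteq> mix (return_pmf x)"
    and eq: "\<forall>n\<ge>1. \<forall>y\<in>S. pmf (mix (return_pmf x) n) y = s * pmf (M' n) y + (1 - s) * pmf (M'' n) y"
    for s :: real and M' M''
  proof -
    obtain c' where c': "M' = mix c'"
      using systems_obtain_mix[OF \<open>M' \<in> systems S\<close>] by blast
    obtain c'' where c'': "M'' = mix c''"
      using systems_obtain_mix[OF \<open>M'' \<in> systems S\<close>] by blast
    have "pmf (return_pmf x) x = s * pmf c' x + (1 - s) * pmf c'' x"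
      by (rule mix_convex_combination) (use eq x in \<open>auto simp: c' c''\<close>)
    then have one: "1 = s * pmf c' x + (1 - s) * pmf c'' x"
      by simp
    have "(1 - s) * pmf c'' x \<le> (1 - s) * 1"
      using s by (intro mult_left_mono) (auto simp: pmf_le_1)
    with one have "s * 1 \<le> s * pmf c' x"
      by simp
    then have "1 \<le> pmf c' x"
      using s by simp
    then have "c' = return_pmf x"
      using pmf_le_1[of c' x] by (intro pmf_one_imp_return) simp
    with ne show False
      by (simp add: c')
  qed
  moreover have "mix (return_pmf x) \<in> systems S"
    by (rule mix_in_systems[OF S]) (use x in auto)
  ultimately show ?thesis
    unfolding extreme_systems_def by blast
qed

lemma extreme_obtain_return:
  assumes S: "\<And>n x. x \<in> S \<Longrightarrow> set_pmf (L n x) \<subseteq> S" and M: "M \<in> extreme_systems S"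
  obtains x where "x \<in> S" "M = mix (return_pmf x)"
proof -
  have "M \<in> systems S"
    using M by (simp add: extreme_systems_def)
  then obtain c where c: "set_pmf c \<subseteq> S" "M = mix c"
    by (rule systems_obtain_mix)
  obtain x where x: "x \<in> set_pmf c"
    using set_pmf_not_empty by fast
  have "pmf c x = 1"
  proof (rule ccontr)
    assume "pmf c x \<noteq> 1"
    then have lt: "pmf c x < 1"
      using pmf_le_1[of c x] by simp
    define c' where "c' = cond_pmf c (- {x})"
    note split = pmf_bind_split_atom[OF lt, folded c'_def]
    have neq: "return_pmf x \<noteq> c" "c' \<noteq> c"
      using lt x by (force, metis split(2) Diff_iff insertI1)
    have "pmf (M n) y = pmf c x * pmf (mix (return_pmf x) n) y + (1 - pmf c x) * pmf (mix c' n) y" if "n \<ge> 1" for n y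
      using that split(1)[of "\<lambda>x. entrance x n" y] by (simp add: c(2) mix_def bind_return_pmf)
    moreover have "mix (return_pmf x) \<in> systems S" "mix c' \<in> systems S"
      using c(1) x split(2) by (auto intro!: mix_in_systems[OF S])
    moreover have "mix (return_pmf x) \<noteq> M" "mix c' \<noteq> M"
      using neq by (simp_all add: c(2) mix_eq_iff)
    moreover have "0 < pmf c x"
      using x by (simp add: pmf_positive)
    ultimately show False
      using M lt unfolding extreme_systems_def by blast
  qed
  then have "c = return_pmf x"
    by (rule pmf_one_imp_return)
  with x c show thesis
    using that by auto
qed

theorem bij_betw_extreme_systems:
  assumes S: "\<And>n x. x \<in> S \<Longrightarrow> set_pmf (L n x) \<subseteq> S"
  shows "bij_betw (\<lambda>x. restrict (entrance x) {1..}) S (extreme_systems S)"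
proof -
  have eq: "restrict (entrance x) {1..} = mix (return_pmf x)" for x
    by (auto simp: mix_def bind_return_pmf)
  show ?thesis
    unfolding eq bij_betw_def
  proof
    show "inj_on (\<lambda>x. mix (return_pmf x)) S"
      by (auto simp: inj_on_def mix_eq_iff)
    show "(\<lambda>x. mix (return_pmf x)) ` S = extreme_systems S"
      using mix_return_extreme[OF S] extreme_obtain_return[OF S] by blast
  qed
qed

end

section \<open>Signatures and their profiles\<close>

lemma downset_eq_lessThan:
  fixes D :: "nat set"
  assumes "finite D" and "\<And>i j. j \<in> D \<Longrightarrow> i \<le> j \<Longrightarrow> i \<in> D"
  shows "D = {..<card D}"
proof (cases "D = {}")
  case False
  have eq: "D = {..<Suc (Max D)}"
  proof
    show "D \<subseteq> {..<Suc (Max D)}"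
      using assms(1) by (auto simp: less_Suc_eq_le)
    show "{..<Suc (Max D)} \<subseteq> D"
      using assms(2)[OF Max_in[OF assms(1) False]] by (auto simp: less_Suc_eq_le)
  qed
  have "card D = Suc (Max D)"
    using arg_cong[OF eq, of card] by simp
  show ?thesis
    unfolding \<open>card D = Suc (Max D)\<close> by (rule eq)
qed simp

text \<open>The conjugate signature; for a partition its values are the column lengths. In these
  coordinates interlacing is a pointwise condition and multiplicities are differences of
  neighbouring values.\<close>

definition profile :: "int list \<Rightarrow> int \<Rightarrow> nat" where
  "profile a x = card {i. i < length a \<and> x \<le> a ! i}"

lemma Sig_nth_mono: "a \<in> Sig k \<Longrightarrow> i \<le> j \<Longrightarrow> j < k \<Longrightarrow> a ! j \<le> a ! i"
  unfolding Sig_def by (cases "i = j") (auto simp: sorted_wrt_iff_nth_less)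

lemma length_Sig: "a \<in> Sig k \<Longrightarrow> length a = k"
  by (simp add: Sig_def)

lemma Sig_ge_iff:
  assumes a: "a \<in> Sig k" and "i < k"
  shows "x \<le> a ! i \<longleftrightarrow> i < profile a x"
proof -
  have "{i. i < k \<and> x \<le> a ! i} = {..<card {i. i < k \<and> x \<le> a ! i}}"
    by (rule downset_eq_lessThan) (use Sig_nth_mono[OF a] in \<open>auto intro: order_trans\<close>)
  then have "i \<in> {i. i < k \<and> x \<le> a ! i} \<longleftrightarrow> i < profile a x"
    unfolding profile_def length_Sig[OF a] by blast
  then show ?thesis
    using assms by simp
qed

lemma profile_le: "a \<in> Sig k \<Longrightarrow> profile a x \<le> k"
  unfolding profile_def using card_mono[of "{..<k}" "{i. i < length a \<and> x \<le> a ! i}"]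
  by (auto simp: length_Sig)

lemma profile_antimono: "x \<le> y \<Longrightarrow> profile a y \<le> profile a x"
  unfolding profile_def by (rule card_mono) auto

lemma profile_inject:
  assumes "a \<in> Sig k" "b \<in> Sig k" "\<And>x. profile a x = profile b x"
  shows "a = b"
proof (rule nth_equalityI)
  fix i assume "i < length a"
  then have i: "i < k"
    using assms by (simp add: length_Sig)
  show "a ! i = b ! i"
    using Sig_ge_iff[OF assms(1) i] Sig_ge_iff[OF assms(2) i] assms(3)
    by (metis order_antisym order_refl)
qed (use assms in \<open>simp add: length_Sig\<close>)

lemma count_list_profile: "profile a x = count_list a x + profile a (x + 1)"
proof -
  have "count_list a x = card {i. i < length a \<and> a ! i = x}"
    by (simp add: count_list_eq_length_filter length_filter_conv_card eq_commute)
  moreover have "{i. i < length a \<and> x \<le> a ! i} = {i. i < length a \<and> a ! i = x} \<union> {i. i < length a \<and> x + 1 \<le> a ! i}"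
    by auto
  ultimately show ?thesis
    unfolding profile_def by (simp add: card_Un_disjoint disjoint_iff)
qed

text \<open>In a horizontal strip every column gains at most one box. A violation at x would break
  interlacing at the row numbered by the smaller of the two profile values.\<close>

lemma prec_Q_iff_profile:
  assumes a: "a \<in> Sig k" and b: "b \<in> Sig k"
  shows "prec_Q k a b \<longleftrightarrow> (\<forall>x. profile a x \<le> profile b x \<and> profile b x \<le> Suc (profile a x))"
proof (intro iffI allI conjI)
  fix x assume ab: "prec_Q k a b"
  show "profile a x \<le> profile b x"
  proof (rule ccontr)
    assume *: "\<not> ?thesis"
    then have "profile b x < k"
      using profile_le[OF a, of x] by simp
    with * ab show False
      using Sig_ge_iff[OF a, of "profile b x" x] Sig_ge_iff[OF b, of "profile b x" x]
      by (auto simp: prec_Q_def dest: order_trans)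
  qed
  show "profile b x \<le> Suc (profile a x)"
  proof (rule ccontr)
    assume *: "\<not> ?thesis"
    then have "Suc (profile a x) < k"
      using profile_le[OF b, of x] by simp
    with * ab show False
      using Sig_ge_iff[OF a, of "profile a x" x] Sig_ge_iff[OF b, of "Suc (profile a x)" x]
      by (auto simp: prec_Q_def dest: order_trans)
  qed
next
  assume *: "\<forall>x. profile a x \<le> profile b x \<and> profile b x \<le> Suc (profile a x)"
  have "a ! i \<le> b ! i" if "i < k" for i
    using * Sig_ge_iff[OF a that, of "a ! i"] Sig_ge_iff[OF b that, of "a ! i"]
    by (meson order_refl order_less_le_trans)
  moreover have "b ! Suc i \<le> a ! i" if "Suc i < k" for i
    using * Sig_ge_iff[OF a Suc_lessD[OF that], of "b ! Suc i"] Sig_ge_iff[OF b that, of "b ! Suc i"]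
    by (meson Suc_less_eq order_refl order_less_le_trans)
  ultimately show "prec_Q k a b"
    using a b by (simp add: prec_Q_def)
qed

text \<open>All parts lie among n consecutive sites starting at lo. The formulation by profiles
  supplies the boundary values k and 0 of the recursions directly.\<close>

definition window :: "nat \<Rightarrow> int \<Rightarrow> nat \<Rightarrow> int list set" where
  "window k lo n = {a \<in> Sig k. profile a lo = k \<and> profile a (lo + int n) = 0}"

lemma window_Sig: "a \<in> window k lo n \<Longrightarrow> a \<in> Sig k"
  by (simp add: window_def)

lemma window_iff:
  assumes a: "a \<in> Sig k"
  shows "a \<in> window k lo n \<longleftrightarrow> (\<forall>i<k. lo \<le> a ! i \<and> a ! i < lo + int n)"
proof -
  have "profile a lo = k \<longleftrightarrow> (\<forall>i<k. lo \<le> a ! i)"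
    using Sig_ge_iff[OF a] profile_le[OF a, of lo] by (metis le_neq_implies_less less_irrefl)
  moreover have "profile a (lo + int n) = 0 \<longleftrightarrow> (\<forall>i<k. a ! i < lo + int n)"
    using Sig_ge_iff[OF a] profile_le[OF a, of "lo + int n"]
    by (metis bot_nat_0.not_eq_extremum linorder_not_le order_less_le_trans not_less_zero)
  ultimately show ?thesis
    using a by (auto simp: window_def)
qed

lemma profile_outside_window:
  assumes a: "a \<in> window k lo n"
  shows "x \<le> lo \<Longrightarrow> profile a x = k" "lo + int n \<le> x \<Longrightarrow> profile a x = 0"
  using profile_antimono[of x lo a] profile_antimono[of "lo + int n" x a] profile_le[of a k x] a
  by (auto simp: window_def)

lemma finite_window: "finite (window k lo n)"
proof (rule finite_subset)
  show "window k lo n \<subseteq> {l. set l \<subseteq> {lo..lo + int n} \<and> length l = k}"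
    using window_iff by (fastforce simp: in_set_conv_nth length_Sig dest: window_Sig)
qed (rule finite_lists_length_eq, simp)

lemma window_mono:
  assumes "lo' \<le> lo" "lo + int n \<le> lo' + int n'"
  shows "window k lo n \<subseteq> window k lo' n'"
proof
  fix a assume a: "a \<in> window k lo n"
  then show "a \<in> window k lo' n'"
    using assms window_iff[OF window_Sig[OF a]] by fastforce
qed

lemma ex_window:
  assumes "finite B" "B \<subseteq> Sig k"
  shows "\<exists>lo n. B \<subseteq> window k lo n"
proof -
  define V where "V = insert 0 (\<Union>b\<in>B. set b)"
  have V: "finite V" "V \<noteq> {}"
    using assms(1) by (auto simp: V_def)
  have "B \<subseteq> window k (Min V) (nat (Max V - Min V + 1))"
  proof
    fix b assume b: "b \<in> B"
    then have bS: "b \<in> Sig k"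
      using assms(2) by auto
    have "Min V \<le> b ! i \<and> b ! i \<le> Max V" if "i < k" for i
    proof -
      have "b ! i \<in> set b"
        using that length_Sig[OF bS] by simp
      then have "b ! i \<in> V"
        using b by (auto simp: V_def)
      then show ?thesis
        using V(1) by simp
    qed
    then show "b \<in> window k (Min V) (nat (Max V - Min V + 1))"
      unfolding window_iff[OF bS] by fastforce
  qed
  then show ?thesis
    by blast
qed

lemma window_position:
  fixes x lo :: int
  shows "x \<le> lo \<or> lo + int n \<le> x \<or> (\<exists>i\<le>n. x = lo + int i)"
proof (cases "lo \<le> x \<and> x \<le> lo + int n")
  case True
  then obtain i where "x = lo + int i"
    by (metis zle_iff_zadd)
  with True show ?thesis
    by auto
qed auto

lemma window_eqI:
  assumes a: "a \<in> window k lo n" and b: "b \<in> window k lo n"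
    and eq: "\<And>i. i \<le> n \<Longrightarrow> profile a (lo + int i) = profile b (lo + int i)"
  shows "a = b"
proof (rule profile_inject[OF window_Sig[OF a] window_Sig[OF b]])
  fix x
  show "profile a x = profile b x"
    using window_position[of x lo n] eq profile_outside_window[OF a, of x] profile_outside_window[OF b, of x]
    by auto
qed

text \<open>Conjugating back: the part in row r is recovered by counting the indices at which
  \<open>g\<close> exceeds r.\<close>

lemma ex_window_profile:
  assumes anti: "\<And>i. i < n \<Longrightarrow> g (Suc i) \<le> g i" and g0: "g 0 = k" and gn: "g n = 0"
  shows "\<exists>b\<in>window k lo n. \<forall>i\<le>n. profile b (lo + int i) = g i"
proof -
  have mono: "g j \<le> g i" if "i \<le> j" "j \<le> n" for i j
    using that
  proof (induction j rule: dec_induct)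
    case (step j)
    then show ?case using anti[of j] by simp
  qed simp
  define c where "c r = card {i. i < n \<and> r < g i}" for r
  have c: "{i. i < n \<and> r < g i} = {..<c r}" for r
    unfolding c_def by (rule downset_eq_lessThan) (auto, meson less_imp_le mono order_less_le_trans)
  have c_iff: "j < c r \<longleftrightarrow> r < g j" if "j \<le> n" for j r
  proof -
    have "j < c r \<longleftrightarrow> j \<in> {i. i < n \<and> r < g i}"
      unfolding c by simp
    then show ?thesis
      using that gn by (cases "j = n") auto
  qed
  \<comment> \<open>For r < k the index 0 is always counted, because \<open>g 0 = k\<close>;
    subtracting 1 makes lo the smallest possible part.\<close>
  define b where "b = map (\<lambda>r. lo + int (c r) - 1) [0..<k]"
  have nth: "b ! r = lo + int (c r) - 1" if "r < k" for r
    using that by (simp add: b_def)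
  have c_mono: "c s \<le> c r" if "r \<le> s" for r s
    unfolding c_def using that by (intro card_mono) auto
  have "b ! s \<le> b ! r" if "r < s" "s < k" for r s
    using that nth c_mono[of r s] by simp
  then have bS: "b \<in> Sig k"
    unfolding Sig_def sorted_wrt_iff_nth_less by (auto simp: b_def simp del: nth_map)
  have prof: "profile b (lo + int i) = g i" if i: "i \<le> n" for i
  proof -
    have "lo + int i \<le> b ! r \<longleftrightarrow> r < g i" if r: "r < k" for r
      using c_iff[of i r] c_iff[of 0 r] i r g0 nth[OF r] by auto
    moreover have "g i \<le> k"
      using mono[of 0 i] g0 i by simp
    ultimately have "{r. r < length b \<and> lo + int i \<le> b ! r} = {..<g i}"
      by (auto simp: length_Sig[OF bS])
    then show ?thesis
      by (simp add: profile_def)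
  qed
  then have "b \<in> window k lo n"
    using bS prof[of 0] prof[of n] g0 gn by (simp add: window_def)
  with prof show ?thesis
    by blast
qed

text \<open>Layer-cake summation: a part exceeds lo by the number of edges below it, and the rows
  reaching an edge are the first \<open>profile\<close> many.\<close>

lemma weighted_sum_profile:
  fixes c :: "nat \<Rightarrow> int"
  assumes a: "a \<in> window k lo n"
  shows "(\<Sum>r<k. c r * a ! r) = lo * (\<Sum>r<k. c r) + (\<Sum>i\<in>{1..<n}. \<Sum>r<profile a (lo + int i). c r)"
proof -
  note aS = window_Sig[OF a]
  have card: "a ! r = lo + (\<Sum>i\<in>{1..<n}. if r < profile a (lo + int i) then 1 else 0)" if r: "r < k" for r
  proof -
    have b: "lo \<le> a ! r" "a ! r < lo + int n"
      using a r window_iff[OF aS] by auto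
    have "{i \<in> {1..<n}. r < profile a (lo + int i)} = {1..nat (a ! r - lo)}"
      using b by (auto simp: Sig_ge_iff[OF aS r, symmetric])
    then show ?thesis
      using b by (simp add: sum.If_cases Int_def conj_commute)
  qed
  have "(\<Sum>r<k. c r * a ! r)
      = (\<Sum>r<k. lo * c r + (\<Sum>i\<in>{1..<n}. if r < profile a (lo + int i) then c r else 0))"
  proof (rule sum.cong[OF refl])
    fix r assume "r \<in> {..<k}"
    then show "c r * a ! r = lo * c r + (\<Sum>i\<in>{1..<n}. if r < profile a (lo + int i) then c r else 0)"
      by (subst card) (auto simp: algebra_simps sum_distrib_left intro!: sum.cong)
  qed
  also have "\<dots> = lo * (\<Sum>r<k. c r) + (\<Sum>i\<in>{1..<n}. \<Sum>r<k. if r < profile a (lo + int i) then c r else 0)"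
    by (simp add: sum.distrib sum_distrib_left sum.swap[of _ "{..<k}"])
  also have "(\<Sum>i\<in>{1..<n}. \<Sum>r<k. if r < profile a (lo + int i) then c r else 0)
      = (\<Sum>i\<in>{1..<n}. \<Sum>r<profile a (lo + int i). c r)"
  proof (rule sum.cong[OF refl])
    fix i
    have "{..<k} \<inter> {r. r < profile a (lo + int i)} = {..<profile a (lo + int i)}"
      using profile_le[OF aS, of "lo + int i"] by auto
    then show "(\<Sum>r<k. if r < profile a (lo + int i) then c r else 0) = (\<Sum>r<profile a (lo + int i). c r)"
      by (simp add: sum.If_cases)
  qed
  finally show ?thesis .
qed

section \<open>Strips as sets of occupied edges\<close>

text \<open>\<open>i\<close> stands for the edge joining \<open>lo + i - 1\<close> and \<open>lo + i\<close>; it is occupied if a part of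
  \<open>a\<close> crosses it on the way to \<open>b\<close>, and by interlacing at most one does.\<close>

definition strip_edges :: "int \<Rightarrow> nat \<Rightarrow> int list \<Rightarrow> int list \<Rightarrow> nat set" where
  "strip_edges lo n a b = {i \<in> {1..<n}. profile b (lo + int i) \<noteq> profile a (lo + int i)}"

lemma profile_strip:
  assumes a: "a \<in> window k lo n" and b: "b \<in> window k lo n" and ab: "prec_Q k a b" and i: "i \<le> n"
  shows "profile b (lo + int i) = profile a (lo + int i) + of_bool (i \<in> strip_edges lo n a b)"
proof -
  have "profile a (lo + int i) \<le> profile b (lo + int i) \<and> profile b (lo + int i) \<le> Suc (profile a (lo + int i))"
    using ab prec_Q_iff_profile[OF window_Sig[OF a] window_Sig[OF b]] by simp
  moreover have "profile b (lo + int i) = profile a (lo + int i)" if "i = 0 \<or> i = n"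
    using that a b by (auto simp: window_def)
  ultimately show ?thesis
    using i by (cases "i = 0 \<or> i = n") (auto simp: strip_edges_def)
qed

text \<open>The occupied edges determine the new profile, so the only constraint on them is that
  this profile still decreases weakly. The two end edges stay empty because both signatures lie in
  the window.\<close>

lemma bij_betw_strip_edges:
  assumes a: "a \<in> window k lo n"
  shows "bij_betw (strip_edges lo n a) {b \<in> window k lo n. prec_Q k a b}
    {A \<in> Pow {1..<n}. \<forall>i<n. profile a (lo + int (Suc i)) + of_bool (Suc i \<in> A)
       \<le> profile a (lo + int i) + of_bool (i \<in> A)}"
  unfolding bij_betw_def
proof
  show "inj_on (strip_edges lo n a) {b \<in> window k lo n. prec_Q k a b}"
    by (auto simp: inj_on_def profile_strip[OF a] intro!: window_eqI)
  show "strip_edges lo n a ` {b \<in> window k lo n. prec_Q k a b} =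
    {A \<in> Pow {1..<n}. \<forall>i<n. profile a (lo + int (Suc i)) + of_bool (Suc i \<in> A)
       \<le> profile a (lo + int i) + of_bool (i \<in> A)}" (is "?L = ?R")
  proof
    show "?L \<subseteq> ?R"
    proof
      fix A assume "A \<in> ?L"
      then obtain b where b: "b \<in> window k lo n" "prec_Q k a b" "A = strip_edges lo n a b"
        by auto
      have "profile a (lo + int (Suc i)) + of_bool (Suc i \<in> A) \<le> profile a (lo + int i) + of_bool (i \<in> A)"
        if "i < n" for i
        using profile_strip[OF a b(1,2), of i] profile_strip[OF a b(1,2), of "Suc i"] that
          profile_antimono[of "lo + int i" "lo + int (Suc i)" b] b(3) by simp
      moreover have "A \<subseteq> {1..<n}"
        by (auto simp: b(3) strip_edges_def)
      ultimately show "A \<in> ?R"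
        by blast
    qed
    show "?R \<subseteq> ?L"
    proof
      fix A assume A: "A \<in> ?R"
      define g where "g i = profile a (lo + int i) + of_bool (i \<in> A)" for i
      have "\<exists>b\<in>window k lo n. \<forall>i\<le>n. profile b (lo + int i) = g i"
        by (rule ex_window_profile) (use A a in \<open>auto simp: g_def window_def\<close>)
      then obtain b where b: "b \<in> window k lo n" and prof: "\<And>i. i \<le> n \<Longrightarrow> profile b (lo + int i) = g i"
        by blast
      have "profile a x \<le> profile b x \<and> profile b x \<le> Suc (profile a x)" for x
      proof -
        show ?thesis
          using window_position[of x lo n] prof profile_outside_window[OF a, of x] profile_outside_window[OF b, of x]
          by (auto simp: g_def)
      qed
      then have "prec_Q k a b"
        by (simp add: prec_Q_iff_profile[OF window_Sig[OF a] window_Sig[OF b]])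
      moreover have "A = strip_edges lo n a b"
        using A prof by (auto simp: strip_edges_def g_def)
      ultimately show "A \<in> ?L"
        using b by blast
    qed
  qed
qed

text \<open>Monotonicity of the new profile can fail only at a site without a part of
  \<open>a\<close> whose right edge is occupied and whose left edge is empty. A weight vanishing
  there can be summed over all edge sets.\<close>

lemma sum_strips:
  fixes G :: "nat set \<Rightarrow> real"
  assumes a: "a \<in> window k lo n"
    and G: "\<And>A i. \<lbrakk>A \<subseteq> {1..<n}; i < n; i \<notin> A; Suc i \<in> A;
      profile a (lo + int i) = profile a (lo + int (Suc i))\<rbrakk> \<Longrightarrow> G A = 0"
  shows "(\<Sum>b | b \<in> window k lo n \<and> prec_Q k a b. G (strip_edges lo n a b)) = (\<Sum>A\<in>Pow {1..<n}. G A)"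
proof -
  let ?R = "{A \<in> Pow {1..<n}. \<forall>i<n. profile a (lo + int (Suc i)) + of_bool (Suc i \<in> A)
       \<le> profile a (lo + int i) + of_bool (i \<in> A)}"
  have "(\<Sum>b | b \<in> window k lo n \<and> prec_Q k a b. G (strip_edges lo n a b)) = (\<Sum>A\<in>?R. G A)"
    by (rule sum.reindex_bij_betw[OF bij_betw_strip_edges[OF a]])
  also have "\<dots> = (\<Sum>A\<in>Pow {1..<n}. G A)"
  proof (rule sum.mono_neutral_left)
    show "\<forall>A\<in>Pow {1..<n} - ?R. G A = 0"
    proof
      fix A assume A: "A \<in> Pow {1..<n} - ?R"
      then obtain i where i: "i < n" and lt: "profile a (lo + int i) + of_bool (i \<in> A)
          < profile a (lo + int (Suc i)) + of_bool (Suc i \<in> A)"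
        by (auto simp: not_le)
      have "profile a (lo + int (Suc i)) \<le> profile a (lo + int i)"
        by (rule profile_antimono) simp
      then have "i \<notin> A" "Suc i \<in> A" "profile a (lo + int i) = profile a (lo + int (Suc i))"
        using lt by (auto split: if_splits simp: of_bool_def)
      with A i show "G A = 0"
        by (intro G) auto
    qed
  qed auto
  finally show ?thesis .
qed

section \<open>Strip weights as products over sites; commutation\<close>

text \<open>Each edge is charged to the site on its left, so edge \<open>Suc i\<close> goes with
  site i and all weights become products over the same sites.\<close>

lemma prod_strip:
  assumes "A \<subseteq> {1..<n}"
  shows "(\<Prod>i\<in>A. g i) = (\<Prod>i<n. if Suc i \<in> A then g (Suc i) else (1::real))"
proof -
  have "(\<Prod>i<n. if Suc i \<in> A then g (Suc i) else 1) = (\<Prod>i\<in>{1..n}. if i \<in> A then g i else 1)"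
    by (simp add: prod.atLeast1_atMost_eq)
  also have "\<dots> = (\<Prod>i\<in>{1..n} \<inter> A. g i)"
    by (simp add: prod.inter_restrict)
  also have "{1..n} \<inter> A = A"
    using assms by auto
  finally show ?thesis
    by simp
qed

text \<open>At an occupied edge exactly one new row reaches that height, the one with index
  \<open>profile a (lo + int i)\<close>. The choices 1 and r for the coefficients give the degree
  and \<open>nstat\<close>.\<close>

lemma weighted_sum_strip:
  fixes c :: "nat \<Rightarrow> int"
  assumes a: "a \<in> window k lo n" and b: "b \<in> window k lo n" and ab: "prec_Q k a b"
  shows "(\<Sum>r<k. c r * b ! r) - (\<Sum>r<k. c r * a ! r) = (\<Sum>i\<in>strip_edges lo n a b. c (profile a (lo + int i)))"
proof -
  let ?A = "strip_edges lo n a b"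
  have "(\<Sum>r<k. c r * b ! r) - (\<Sum>r<k. c r * a ! r)
      = (\<Sum>i\<in>{1..<n}. (\<Sum>r<profile b (lo + int i). c r) - (\<Sum>r<profile a (lo + int i). c r))"
    unfolding weighted_sum_profile[OF a] weighted_sum_profile[OF b] by (simp add: sum_subtractf)
  also have "\<dots> = (\<Sum>i\<in>{1..<n}. if i \<in> ?A then c (profile a (lo + int i)) else 0)"
    by (rule sum.cong[OF refl]) (simp add: profile_strip[OF a b ab])
  also have "\<dots> = (\<Sum>i\<in>{1..<n} \<inter> ?A. c (profile a (lo + int i)))"
    by (simp add: sum.inter_restrict)
  also have "{1..<n} \<inter> ?A = ?A"
    by (auto simp: strip_edges_def)
  finally show ?thesis .
qed

text \<open>Macdonald's n(\<lambda>), extended to signatures; the exponent of t in the principal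
  specialization.\<close>

definition nstat :: "int list \<Rightarrow> int" where
  "nstat a = (\<Sum>r<length a. int r * a ! r)"

lemma strip_edges_subset: "strip_edges lo n a b \<subseteq> {1..<n}"
  by (auto simp: strip_edges_def)

lemma powi_sum_list_strip:
  assumes a: "a \<in> window k lo n" and b: "b \<in> window k lo n" and ab: "prec_Q k a b"
  shows "(y::real) powi (sum_list b - sum_list a) = (\<Prod>i<n. if Suc i \<in> strip_edges lo n a b then y else 1)"
proof -
  have "sum_list b - sum_list a = int (card (strip_edges lo n a b))"
    using weighted_sum_strip[OF a b ab, of "\<lambda>_. 1"] length_Sig[OF window_Sig[OF a]] length_Sig[OF window_Sig[OF b]]
    by (simp add: sum_list_sum_nth atLeast0LessThan)
  then show ?thesis
    using prod_strip[OF strip_edges_subset, of "\<lambda>_. y"] by (simp add: power_int_of_nat)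
qed

lemma powi_nstat_strip:
  assumes a: "a \<in> window k lo n" and b: "b \<in> window k lo n" and ab: "prec_Q k a b"
  shows "(t::real) powi (nstat b - nstat a)
    = (\<Prod>i<n. if Suc i \<in> strip_edges lo n a b then t ^ profile a (lo + int (Suc i)) else 1)"
proof -
  have "nstat b - nstat a = int (\<Sum>i\<in>strip_edges lo n a b. profile a (lo + int i))"
    using weighted_sum_strip[OF a b ab, of int] length_Sig[OF window_Sig[OF a]] length_Sig[OF window_Sig[OF b]]
    by (simp add: nstat_def)
  then show ?thesis
    using prod_strip[OF strip_edges_subset, of "\<lambda>i. t ^ profile a (lo + int i)"]
    by (simp only: power_int_of_nat power_sum)
qed

lemma prod_window_count:
  fixes g :: "int \<Rightarrow> real"
  assumes a: "a \<in> window k lo n"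
  shows "(\<Prod>x | x \<in> set a \<and> Q x. g x) = (\<Prod>i<n. if lo + int i \<in> set a \<and> Q (lo + int i) then g (lo + int i) else 1)"
proof -
  have sub: "{x \<in> set a. Q x} \<subseteq> (\<lambda>i. lo + int i) ` {..<n}"
  proof
    fix x assume "x \<in> {x \<in> set a. Q x}"
    then have "lo \<le> x" "x < lo + int n"
      using a window_iff[OF window_Sig[OF a]] length_Sig[OF window_Sig[OF a]] by (auto simp: in_set_conv_nth)
    then have "x = lo + int (nat (x - lo))" "nat (x - lo) < n"
      by auto
    then show "x \<in> (\<lambda>i. lo + int i) ` {..<n}"
      by blast
  qed
  have "(\<Prod>x | x \<in> set a \<and> Q x. g x) = (\<Prod>x\<in>(\<lambda>i. lo + int i) ` {..<n}. if x \<in> {x \<in> set a. Q x} then g x else 1)"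
    using prod.inter_restrict[of "(\<lambda>i. lo + int i) ` {..<n}" g "{x \<in> set a. Q x}"] sub
    by (simp add: inf.absorb2)
  also have "\<dots> = (\<Prod>i<n. if lo + int i \<in> {x \<in> set a. Q x} then g (lo + int i) else 1)"
    by (subst prod.reindex) (auto simp: inj_on_def)
  finally show ?thesis
    by simp
qed

lemma count_list_strip:
  assumes a: "a \<in> window k lo n" and b: "b \<in> window k lo n" and ab: "prec_Q k a b" and i: "i < n"
  shows "count_list a (lo + int i) + of_bool (i \<in> strip_edges lo n a b)
    = count_list b (lo + int i) + of_bool (Suc i \<in> strip_edges lo n a b)"
  using profile_strip[OF a b ab, of i] profile_strip[OF a b ab, of "Suc i"] i
    count_list_profile[of a "lo + int i"] count_list_profile[of b "lo + int i"]
  by (simp add: ac_simps)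

lemma hl_phi_strip:
  assumes a: "a \<in> window k lo n" and b: "b \<in> window k lo n" and ab: "prec_Q k a b"
  defines "A \<equiv> strip_edges lo n a b"
  shows "hl_phi t a b = (\<Prod>i<n. if i \<notin> A \<and> Suc i \<in> A
    then 1 - t ^ (profile a (lo + int i) - profile a (lo + int (Suc i))) else 1)"
proof -
  have "{x. count_list a x = count_list b x + 1} = {x. x \<in> set a \<and> count_list a x = count_list b x + 1}"
    using count_notin by fastforce
  then have "hl_phi t a b = (\<Prod>x | x \<in> set a \<and> count_list a x = count_list b x + 1. 1 - t ^ count_list a x)"
    by (simp add: hl_phi_def)
  also have "\<dots> = (\<Prod>i<n. if lo + int i \<in> set a \<and> count_list a (lo + int i) = count_list b (lo + int i) + 1
      then 1 - t ^ count_list a (lo + int i) else 1)"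
    by (rule prod_window_count[OF a])
  also have "\<dots> = (\<Prod>i<n. if i \<notin> A \<and> Suc i \<in> A
    then 1 - t ^ (profile a (lo + int i) - profile a (lo + int (Suc i))) else 1)"
  proof (rule prod.cong[OF refl])
    fix i assume "i \<in> {..<n}"
    then have i: "i < n" by simp
    have "count_list a (lo + int i) + of_bool (i \<in> A) = count_list b (lo + int i) + of_bool (Suc i \<in> A)"
      unfolding A_def by (rule count_list_strip[OF a b ab i])
    moreover have "lo + int i \<in> set a \<longleftrightarrow> count_list a (lo + int i) \<noteq> 0"
      by (simp add: count_list_0_iff)
    ultimately have "lo + int i \<in> set a \<and> count_list a (lo + int i) = count_list b (lo + int i) + 1 \<longleftrightarrow> i \<notin> A \<and> Suc i \<in> A"
      by (auto simp: of_bool_def simp del: count_list_0_iff split: if_splits)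
    moreover have "count_list a (lo + int i) = profile a (lo + int i) - profile a (lo + int (Suc i))"
      using count_list_profile[of a "lo + int i"] by (simp add: ac_simps)
    ultimately show "(if lo + int i \<in> set a \<and> count_list a (lo + int i) = count_list b (lo + int i) + 1
      then 1 - t ^ count_list a (lo + int i) else 1) = (if i \<notin> A \<and> Suc i \<in> A
    then 1 - t ^ (profile a (lo + int i) - profile a (lo + int (Suc i))) else 1)"
      by simp
  qed
  finally show ?thesis .
qed

section \<open>Transfer recursions and commutation\<close>

text \<open>The Boolean state is the occupation of the last edge.\<close>

fun transfer :: "(nat \<Rightarrow> bool \<Rightarrow> bool \<Rightarrow> real) \<Rightarrow> nat \<Rightarrow> bool \<Rightarrow> real" where
  "transfer w 0 b = of_bool (\<not> b)"
| "transfer w (Suc n) b = transfer w n False * w n False b + transfer w n True * w n True b"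

text \<open>Induction by deciding whether the newest edge is occupied; the initial vector says that
  edge 0 is empty.\<close>

lemma transfer_eq_sum:
  "transfer w n b = (\<Sum>A | A \<in> Pow {1..n} \<and> (n \<in> A \<longleftrightarrow> b). \<Prod>i<n. w i (i \<in> A) (Suc i \<in> A))"
proof (induction n arbitrary: b)
  case 0
  have "{A. A \<in> Pow {1..0::nat} \<and> (0 \<in> A \<longleftrightarrow> b)} = (if b then {} else {{}})"
    by auto
  then show ?case by simp
next
  case (Suc n)
  define e :: "nat set \<Rightarrow> nat set" where "e A = (if b then insert (Suc n) A else A)" for A
  have bij: "bij_betw e (Pow {1..n}) {A. A \<in> Pow {1..Suc n} \<and> (Suc n \<in> A \<longleftrightarrow> b)}"
    by (rule bij_betw_byWitness[where f' = "\<lambda>A. A - {Suc n}"]) (auto simp: e_def split: if_splits)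
  have val: "(\<Prod>i<Suc n. w i (i \<in> e A) (Suc i \<in> e A)) = (\<Prod>i<n. w i (i \<in> A) (Suc i \<in> A)) * w n (n \<in> A) b"
    if "A \<in> Pow {1..n}" for A
  proof -
    have "(\<Prod>i<n. w i (i \<in> e A) (Suc i \<in> e A)) = (\<Prod>i<n. w i (i \<in> A) (Suc i \<in> A))"
      by (rule prod.cong) (auto simp: e_def)
    moreover have "n \<in> e A \<longleftrightarrow> n \<in> A" "Suc n \<in> e A \<longleftrightarrow> b"
      using that by (auto simp: e_def)
    ultimately show ?thesis
      by simp
  qed
  have "(\<Sum>A | A \<in> Pow {1..Suc n} \<and> (Suc n \<in> A \<longleftrightarrow> b). \<Prod>i<Suc n. w i (i \<in> A) (Suc i \<in> A))
      = (\<Sum>A\<in>Pow {1..n}. \<Prod>i<Suc n. w i (i \<in> e A) (Suc i \<in> e A))"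
    by (rule sum.reindex_bij_betw[OF bij, symmetric])
  also have "\<dots> = (\<Sum>A\<in>Pow {1..n}. (\<Prod>i<n. w i (i \<in> A) (Suc i \<in> A)) * w n (n \<in> A) b)"
    by (rule sum.cong[OF refl]) (rule val)
  also have "\<dots> = (\<Sum>A | A \<in> Pow {1..n} \<and> (n \<in> A \<longleftrightarrow> False). (\<Prod>i<n. w i (i \<in> A) (Suc i \<in> A)) * w n (n \<in> A) b)
      + (\<Sum>A | A \<in> Pow {1..n} \<and> (n \<in> A \<longleftrightarrow> True). (\<Prod>i<n. w i (i \<in> A) (Suc i \<in> A)) * w n (n \<in> A) b)"
    by (subst sum.union_disjoint[symmetric]) (auto intro!: sum.cong)
  also have "(\<Sum>A | A \<in> Pow {1..n} \<and> (n \<in> A \<longleftrightarrow> False). (\<Prod>i<n. w i (i \<in> A) (Suc i \<in> A)) * w n (n \<in> A) b)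
      = transfer w n False * w n False b"
    unfolding Suc.IH sum_distrib_right by (rule sum.cong) auto
  also have "(\<Sum>A | A \<in> Pow {1..n} \<and> (n \<in> A \<longleftrightarrow> True). (\<Prod>i<n. w i (i \<in> A) (Suc i \<in> A)) * w n (n \<in> A) b)
      = transfer w n True * w n True b"
    unfolding Suc.IH sum_distrib_right by (rule sum.cong) auto
  finally show ?case
    by simp
qed

lemma transfer_False: "transfer w n False = (\<Sum>A\<in>Pow {1..<n}. \<Prod>i<n. w i (i \<in> A) (Suc i \<in> A))"
proof -
  have "{A. A \<in> Pow {1..n} \<and> (n \<in> A \<longleftrightarrow> False)} = Pow {1..<n}"
    by (fastforce simp: less_le)
  then show ?thesis
    by (simp add: transfer_eq_sum)
qed

text \<open>A one-variable skew P-function: with its arguments reversed, \<open>hl_phi\<close> is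
  the coefficient psi of the branching rule for P.\<close>

definition strip_weight :: "nat \<Rightarrow> real \<Rightarrow> real \<Rightarrow> int list \<Rightarrow> int list \<Rightarrow> real" where
  "strip_weight k t y a b = (if prec_Q k a b then y powi (sum_list b - sum_list a) * hl_phi t a b else 0)"

text \<open>\<open>p\<close> and \<open>q\<close> are the profiles of the lowest signature at the
  left and right edge of the site, \<open>d\<close> and \<open>d'\<close> the numbers of strips
  occupying these edges, and \<open>b\<close> and \<open>b'\<close> tell whether the first strip
  does. The second strip occupies an edge iff the difference is 1, and \<open>p + of_bool b\<close>,
  \<open>q + of_bool b'\<close> are the profiles of the middle signature.\<close>

definition site_weight :: "real \<Rightarrow> real \<Rightarrow> real \<Rightarrow> nat \<Rightarrow> nat \<Rightarrow> int \<Rightarrow> int \<Rightarrow> bool \<Rightarrow> bool \<Rightarrow> real" where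
  "site_weight t y z p q d d' b b' =
     (if b' then y else 1) * (if \<not> b \<and> b' then 1 - t ^ (p - q) else 1) *
     (if d' - of_bool b' \<in> {0, 1} then 1 else 0) * (if d' - of_bool b' = 1 then z else 1) *
     (if d - of_bool b \<noteq> 1 \<and> d' - of_bool b' = 1 then 1 - t ^ (p + of_bool b - (q + of_bool b')) else 1)"

text \<open>
  \<open>u\<close> and \<open>v\<close> are the state vectors of the transfer recursions for \<open>T(y) T(z)\<close> and
  \<open>T(z) T(y)\<close>, where \<open>d\<close> of the two strips occupy the current edge and the Boolean tells whether the
  first one does. For \<open>d = 1\<close> the two equations play the role of the R-matrix of the six-vertex model.
\<close>

definition exchange :: "real \<Rightarrow> real \<Rightarrow> real \<Rightarrow> int \<Rightarrow> (bool \<Rightarrow> real) \<Rightarrow> (bool \<Rightarrow> real) \<Rightarrow> bool" where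
  "exchange t y z d u v \<longleftrightarrow>
     (if d = 0 then u False = v False \<and> u True = 0 \<and> v True = 0
      else if d = 1 then u True + u False = v True + v False \<and>
        y * u False + z * t * u True = z * v False + y * t * v True
      else if d = 2 then u True = v True \<and> u False = 0 \<and> v False = 0
      else u False = 0 \<and> v False = 0 \<and> u True = 0 \<and> v True = 0)"

text \<open>Let S be the sum of the two components of u and R =
  \<open>y * u False + z * t * u True\<close>. For \<open>d = d' = 1\<close> and m =
  \<open>t ^ (p - q)\<close>, one site maps S to (y + z) S - m R and R to y z (1 + t - t m) S. Both
  expressions are symmetric in y and z, so equality of the pairs for u and v persists. The other
  cases enter or leave this one through multiples of S or of a single component.\<close>

lemma exchange_step:
  assumes ex: "exchange t y z d u v" and qp: "q \<le> p"
    and u': "\<And>b. u' b = u False * site_weight t y z p q d d' False b + u True * site_weight t y z p q d d' True b"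
    and v': "\<And>b. v' b = v False * site_weight t z y p q d d' False b + v True * site_weight t z y p q d d' True b"
  shows "exchange t y z d' u' v'"
proof -
  \<comment> \<open>If the first strip brings a part into the site and takes none out, the
    multiplicity seen by the second strip is one larger, whence the extra factor t.\<close>
  have M: "t ^ (Suc p - q) = t * t ^ (p - q)"
    using qp by (simp add: Suc_diff_le)
  consider "d = 0" | "d = 1" | "d = 2" | "d \<noteq> 0" "d \<noteq> 1" "d \<noteq> 2"
    by blast
  then show ?thesis
  proof cases
    case 1
    then show ?thesis
      using ex by (auto simp: exchange_def u' v' site_weight_def algebra_simps)
  next
    case 3
    then show ?thesis
      using ex by (auto simp: exchange_def u' v' site_weight_def algebra_simps)
  next
    case 4
    then show ?thesis
      using ex by (auto simp: exchange_def u' v')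
  next
    case 2
    then have e1: "u True + u False = v True + v False"
      and e2: "y * u False + z * t * u True = z * v False + y * t * v True"
      using ex by (auto simp: exchange_def)
    consider "d' = 0" | "d' = 1" | "d' = 2" | "d' \<noteq> 0" "d' \<noteq> 1" "d' \<noteq> 2"
      by blast
    then show ?thesis
    proof cases
      case 1
      then show ?thesis
        using \<open>d = 1\<close> e1 by (auto simp: exchange_def u' v' site_weight_def)
    next
      case 3
      have "u True * (y * z * (1 - t ^ (p - q))) + u False * (y * z * (1 - t ^ (p - q)))
          = v True * (y * z * (1 - t ^ (p - q))) + v False * (y * z * (1 - t ^ (p - q)))"
        unfolding distrib_right[symmetric] e1 ..
      then show ?thesis
        using \<open>d = 1\<close> 3 by (auto simp: exchange_def u' v' site_weight_def algebra_simps)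
    next
      case 4
      then show ?thesis
        using \<open>d = 1\<close> by (auto simp: exchange_def u' v' site_weight_def)
    next
      case 2
      define m where "m = t ^ (p - q)"
      have uT': "u' True = y * (u True + (1 - m) * u False)" and uF': "u' False = z * (u False + (1 - t * m) * u True)"
        and vT': "v' True = z * (v True + (1 - m) * v False)" and vF': "v' False = y * (v False + (1 - t * m) * v True)"
        using \<open>d = 1\<close> 2 by (simp_all add: u' v' site_weight_def M m_def[symmetric] algebra_simps)
      have "u' True + u' False = (y + z) * (u True + u False) - m * (y * u False + z * t * u True)"
        unfolding uT' uF' by (simp add: algebra_simps)
      also have "\<dots> = v' True + v' False"
        unfolding e1 e2 vT' vF' by (simp add: algebra_simps)
      finally have 1: "u' True + u' False = v' True + v' False" .
      have "y * u' False + z * t * u' True = y * z * (1 + t - t * m) * (u True + u False)"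
        unfolding uT' uF' by (simp add: algebra_simps)
      also have "\<dots> = z * v' False + y * t * v' True"
        unfolding e1 vT' vF' by (simp add: algebra_simps)
      finally show ?thesis
        using 1 2 by (simp add: exchange_def)
    qed
  qed
qed

text \<open>With both ends fixed, the edges of the first strip determine the middle signature and
  hence the second strip. If the latter is not a strip, the occupation left over at some edge is
  neither 0 nor 1 and a site factor vanishes.\<close>

lemma sum_strip_weight_eq_transfer:
  assumes a: "a \<in> window k lo n" and c: "c \<in> window k lo n"
  defines "f \<equiv> \<lambda>i. profile a (lo + int i)"
    and "d \<equiv> \<lambda>i. int (profile c (lo + int i)) - int (profile a (lo + int i))"
  shows "(\<Sum>b\<in>window k lo n. strip_weight k t y a b * strip_weight k t z b c)
    = transfer (\<lambda>i. site_weight t y z (f i) (f (Suc i)) (d i) (d (Suc i))) n False"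
proof -
  define G where "G A = (\<Prod>i<n. site_weight t y z (f i) (f (Suc i)) (d i) (d (Suc i)) (i \<in> A) (Suc i \<in> A))" for A
  have term_eq: "strip_weight k t y a b * strip_weight k t z b c = G (strip_edges lo n a b)"
    if b: "b \<in> window k lo n" and ab: "prec_Q k a b" for b
  proof -
    define A where "A = strip_edges lo n a b"
    have fb: "profile b (lo + int i) = f i + of_bool (i \<in> A)" if "i \<le> n" for i
      using profile_strip[OF a b ab that] by (simp add: f_def A_def)
    have fc: "int (profile c (lo + int i)) = d i + int (f i)" for i
      by (simp add: d_def f_def)
    show ?thesis
    proof (cases "prec_Q k b c")
      case True
      define B where "B = strip_edges lo n b c"
      have B: "i \<in> B \<longleftrightarrow> d i - of_bool (i \<in> A) = 1" and v: "d i - of_bool (i \<in> A) \<in> {0, 1}" if "i \<le> n" for i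
      proof -
        have "int (profile c (lo + int i)) = int (profile b (lo + int i)) + of_bool (i \<in> B)"
          using profile_strip[OF b c True that] by (simp add: B_def)
        then have *: "d i - of_bool (i \<in> A) = of_bool (i \<in> B)"
          unfolding fc fb[OF that] by simp
        show "i \<in> B \<longleftrightarrow> d i - of_bool (i \<in> A) = 1" "d i - of_bool (i \<in> A) \<in> {0, 1}"
          unfolding * by auto
      qed
      have "strip_weight k t y a b * strip_weight k t z b c
          = (\<Prod>i<n. if Suc i \<in> A then y else 1) * (\<Prod>i<n. if i \<notin> A \<and> Suc i \<in> A then 1 - t ^ (f i - f (Suc i)) else 1) *
            ((\<Prod>i<n. if Suc i \<in> B then z else 1) * (\<Prod>i<n. if i \<notin> B \<and> Suc i \<in> B
              then 1 - t ^ (profile b (lo + int i) - profile b (lo + int (Suc i))) else 1))"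
        using ab True
        by (simp only: strip_weight_def if_True powi_sum_list_strip[OF a b ab] powi_sum_list_strip[OF b c True]
            hl_phi_strip[OF a b ab] hl_phi_strip[OF b c True] A_def B_def f_def)
      also have "\<dots> = G A"
        unfolding G_def prod.distrib[symmetric]
      proof (rule prod.cong[OF refl])
        fix i assume "i \<in> {..<n}"
        then have i: "i \<le> n" "Suc i \<le> n" by auto
        show "(if Suc i \<in> A then y else 1) * (if i \<notin> A \<and> Suc i \<in> A then 1 - t ^ (f i - f (Suc i)) else 1) *
            ((if Suc i \<in> B then z else 1) * (if i \<notin> B \<and> Suc i \<in> B
              then 1 - t ^ (profile b (lo + int i) - profile b (lo + int (Suc i))) else 1))
          = site_weight t y z (f i) (f (Suc i)) (d i) (d (Suc i)) (i \<in> A) (Suc i \<in> A)"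
          unfolding site_weight_def fb[OF i(1)] fb[OF i(2)] B[OF i(1)] B[OF i(2)]
          using v[OF i(2)] by (simp only: if_True mult_1_right mult.assoc)
      qed
      finally show ?thesis
        by (simp add: A_def)
    next
      case False
      then obtain x where x: "\<not> (profile b x \<le> profile c x \<and> profile c x \<le> Suc (profile b x))"
        using prec_Q_iff_profile[OF window_Sig[OF b] window_Sig[OF c]] by blast
      then obtain i where i: "x = lo + int i" "i \<le> n"
        using window_position[of x lo n] profile_outside_window[OF b, of x] profile_outside_window[OF c, of x] by auto
      \<comment> \<open>A site weight tests only its right edge, so the offending edge has to be a
        successor.\<close>
      have "i \<noteq> 0"
      proof
        assume "i = 0"
        then show False
          using x i b c by (simp add: window_def)
      qed
      then obtain j where j: "i = Suc j"
        by (cases i) auto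
      have "\<not> (int (profile b x) \<le> int (profile c x) \<and> int (profile c x) \<le> int (profile b x) + 1)"
        using x by linarith
      then have "d (Suc j) - of_bool (Suc j \<in> A) \<notin> {0, 1}"
        unfolding i(1) fc fb[OF i(2)] unfolding j by auto
      then have "site_weight t y z (f j) (f (Suc j)) (d j) (d (Suc j)) (j \<in> A) (Suc j \<in> A) = 0"
        by (simp add: site_weight_def)
      then have "G A = 0"
        unfolding G_def using i j by (intro prod_zero) auto
      with False show ?thesis
        by (simp add: strip_weight_def A_def)
    qed
  qed
  have "(\<Sum>b\<in>window k lo n. strip_weight k t y a b * strip_weight k t z b c)
      = (\<Sum>b | b \<in> window k lo n \<and> prec_Q k a b. strip_weight k t y a b * strip_weight k t z b c)"
    by (rule sum.mono_neutral_right) (auto simp: finite_window strip_weight_def)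
  also have "\<dots> = (\<Sum>b | b \<in> window k lo n \<and> prec_Q k a b. G (strip_edges lo n a b))"
    by (rule sum.cong[OF refl]) (use term_eq in auto)
  also have "\<dots> = (\<Sum>A\<in>Pow {1..<n}. G A)"
  proof (rule sum_strips[OF a])
    fix A i assume i: "i < n" "i \<notin> A" "Suc i \<in> A" "profile a (lo + int i) = profile a (lo + int (Suc i))"
    then have "site_weight t y z (f i) (f (Suc i)) (d i) (d (Suc i)) (i \<in> A) (Suc i \<in> A) = 0"
      by (simp add: site_weight_def f_def)
    then show "G A = 0"
      unfolding G_def using i(1) by (intro prod_zero bexI[of _ i]) auto
  qed
  finally show ?thesis
    by (simp add: transfer_False G_def)
qed

text \<open>Symmetry of a two-variable skew P-function. The exchange relation starts at the empty
  edge 0, passes through every site, and at the empty edge n reduces to the claimed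
  equality.\<close>

lemma strip_weight_commute:
  assumes a: "a \<in> window k lo n" and c: "c \<in> window k lo n"
  shows "(\<Sum>b\<in>window k lo n. strip_weight k t y a b * strip_weight k t z b c)
    = (\<Sum>b\<in>window k lo n. strip_weight k t z a b * strip_weight k t y b c)"
proof -
  define f where "f i = profile a (lo + int i)" for i
  define d where "d i = int (profile c (lo + int i)) - int (profile a (lo + int i))" for i
  let ?w = "\<lambda>y z i. site_weight t y z (f i) (f (Suc i)) (d i) (d (Suc i))"
  have d: "d 0 = 0" "d n = 0"
    using a c by (auto simp: d_def window_def)
  have "exchange t y z (d m) (transfer (?w y z) m) (transfer (?w z y) m)" for m
  proof (induction m)
    case 0
    then show ?case by (simp add: exchange_def d)
  next
    case (Suc m)
    show ?case
      by (rule exchange_step[OF Suc.IH, of "f (Suc m)" "f m"]) (simp_all add: f_def profile_antimono)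
  qed
  from this[of n] have "transfer (?w y z) n False = transfer (?w z y) n False"
    using d by (simp add: exchange_def)
  then show ?thesis
    unfolding sum_strip_weight_eq_transfer[OF a c] f_def d_def .
qed

section \<open>Stochasticity and the principal specialization\<close>

lemma sum_strip_kernel_window:
  assumes a: "a \<in> window k lo n"
  defines "f \<equiv> \<lambda>i. profile a (lo + int i)"
  shows "(\<Sum>b\<in>window k lo n. strip_weight k t y a b * t powi (nstat b - nstat a))
    = transfer (\<lambda>i b b'. (if b' then y * t ^ f (Suc i) else 1) * (if \<not> b \<and> b' then 1 - t ^ (f i - f (Suc i)) else 1)) n False"
proof -
  let ?w = "\<lambda>i b b'. (if b' then y * t ^ f (Suc i) else 1) * (if \<not> b \<and> b' then 1 - t ^ (f i - f (Suc i)) else 1)"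
  define G where "G A = (\<Prod>i<n. ?w i (i \<in> A) (Suc i \<in> A))" for A
  have term_eq: "strip_weight k t y a b * t powi (nstat b - nstat a) = G (strip_edges lo n a b)"
    if b: "b \<in> window k lo n" and ab: "prec_Q k a b" for b
  proof -
    have "strip_weight k t y a b * t powi (nstat b - nstat a)
       = (\<Prod>i<n. if Suc i \<in> strip_edges lo n a b then y else 1) *
         (\<Prod>i<n. if i \<notin> strip_edges lo n a b \<and> Suc i \<in> strip_edges lo n a b then 1 - t ^ (f i - f (Suc i)) else 1) *
         (\<Prod>i<n. if Suc i \<in> strip_edges lo n a b then t ^ f (Suc i) else 1)"
      using ab by (simp only: strip_weight_def if_True powi_sum_list_strip[OF a b ab] powi_nstat_strip[OF a b ab]
            hl_phi_strip[OF a b ab] f_def)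
    also have "\<dots> = G (strip_edges lo n a b)"
      unfolding G_def prod.distrib[symmetric] by (rule prod.cong) auto
    finally show ?thesis .
  qed
  have "(\<Sum>b\<in>window k lo n. strip_weight k t y a b * t powi (nstat b - nstat a))
      = (\<Sum>b | b \<in> window k lo n \<and> prec_Q k a b. strip_weight k t y a b * t powi (nstat b - nstat a))"
    by (rule sum.mono_neutral_right) (auto simp: finite_window strip_weight_def)
  also have "\<dots> = (\<Sum>b | b \<in> window k lo n \<and> prec_Q k a b. G (strip_edges lo n a b))"
    by (rule sum.cong[OF refl]) (use term_eq in auto)
  also have "\<dots> = (\<Sum>A\<in>Pow {1..<n}. G A)"
  proof (rule sum_strips[OF a])
    fix A i assume i: "i < n" "i \<notin> A" "Suc i \<in> A" "profile a (lo + int i) = profile a (lo + int (Suc i))"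
    then have "?w i (i \<in> A) (Suc i \<in> A) = 0"
      by (simp add: f_def)
    then show "G A = 0"
      unfolding G_def using i(1) by (intro prod_zero bexI[of _ i]) auto
  qed
  finally show ?thesis
    unfolding transfer_False G_def .
qed

lemma nn_has_sum_exhaustion:
  fixes g :: "'a \<Rightarrow> real"
  assumes g: "\<And>x. x \<in> A \<Longrightarrow> 0 \<le> g x" and fin: "\<And>n. finite (W n)"
    and sub: "\<And>n. W n \<subseteq> A" and cover: "\<And>X. finite X \<Longrightarrow> X \<subseteq> A \<Longrightarrow> \<forall>\<^sub>F n in sequentially. X \<subseteq> W n"
    and lim: "(\<lambda>n. sum g (W n)) \<longlonglongrightarrow> s"
  shows "(g has_sum s) A"
proof -
  have fl: "filterlim W (finite_subsets_at_top A) sequentially"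
    unfolding filterlim_finite_subsets_at_top using cover fin sub by auto
  have "sum g X \<le> s" if X: "finite X" "X \<subseteq> A" for X
  proof (rule tendsto_lowerbound[OF lim])
    show "\<forall>\<^sub>F n in sequentially. sum g X \<le> sum g (W n)"
      using cover[OF X] by eventually_elim (use g sub fin in \<open>auto intro!: sum_mono2\<close>)
  qed simp
  then have "g summable_on A"
    using g by (intro nonneg_bdd_above_summable_on) (auto simp: bdd_above_def intro!: exI[of _ s])
  then have hs: "(g has_sum infsum g A) A"
    by (rule has_sum_infsum)
  have "(\<lambda>n. sum g (W n)) \<longlonglongrightarrow> infsum g A"
    by (rule filterlim_compose[OF hs[unfolded has_sum_def] fl])
  with lim have "s = infsum g A"
    by (rule LIMSEQ_unique)
  with hs show ?thesis
    by simp
qed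

lemma hl_phi_nonneg:
  assumes "0 \<le> t" "t \<le> 1"
  shows "0 \<le> hl_phi t b a"
  unfolding hl_phi_def using assms by (intro prod_nonneg) (simp add: power_le_one del: power_Suc)

lemma strip_weight_nonneg:
  assumes "0 \<le> t" "t \<le> 1" "0 \<le> y"
  shows "0 \<le> strip_weight k t y a b"
  unfolding strip_weight_def using assms by (simp add: hl_phi_nonneg)

text \<open>The one-variable skew Cauchy identity at the principal point. Windows are extended to
  the right only, and the limit of the two-state recursion is read off from a conserved
  quantity.\<close>

theorem strip_kernel_has_sum:
  assumes t: "0 < t" "t < 1" and y: "0 < y" "y < 1" and a: "a \<in> Sig k"
  shows "((\<lambda>b. strip_weight k t y a b * t powi (nstat b - nstat a)) has_sum (1 - y * t ^ k) / (1 - y)) (Sig k)"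
proof -
  obtain lo n0 where a0: "a \<in> window k lo n0"
    using ex_window[of "{a}" k] a by auto
  define f where "f i = profile a (lo + int i)" for i
  define w where "w i b b' = (if b' then y * t ^ f (Suc i) else 1) * (if \<not> b \<and> b' then 1 - t ^ (f i - f (Suc i)) else 1)" for i b b'
  define g where "g b = strip_weight k t y a b * t powi (nstat b - nstat a)" for b
  have f0: "f 0 = k"
    using a0 by (simp add: f_def window_def)
  have fz: "f m = 0" if "n0 \<le> m" for m
    using profile_outside_window(2)[OF a0, of "lo + int m"] that by (simp add: f_def)
  have f_anti: "f (Suc i) \<le> f i" for i
    by (simp add: f_def profile_antimono)
  have inv: "transfer w m True + (1 - y * t ^ f m) * transfer w m False = 1 - y * t ^ k" for m
  proof (induction m)
    case 0
    then show ?case by (simp add: f0)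
  next
    case (Suc m)
    have tf: "t ^ f m = t ^ f (Suc m) * t ^ (f m - f (Suc m))"
      using f_anti[of m] by (simp add: power_add[symmetric])
    show ?case
      using Suc.IH unfolding tf by (simp add: w_def algebra_simps)
  qed
  \<comment> \<open>Beyond n0 no part of \<open>a\<close> is left, so opening an edge has weight
    \<open>1 - t ^ 0 = 0\<close>; an occupied edge can only prolong a run, at the price y.\<close>
  have T: "transfer w (n0 + m) True = y ^ m * transfer w n0 True" for m
    by (induction m) (simp_all add: w_def fz)
  have "(\<lambda>m. y ^ m * transfer w n0 True) \<longlonglongrightarrow> 0 * transfer w n0 True"
    using y by (intro tendsto_intros LIMSEQ_power_zero) auto
  then have T0: "(\<lambda>m. transfer w (n0 + m) True) \<longlonglongrightarrow> 0"
    unfolding T by simp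
  have F: "transfer w (n0 + m) False = (1 - y * t ^ k - transfer w (n0 + m) True) / (1 - y)" for m
    using inv[of "n0 + m"] y by (simp add: fz field_simps)
  have sumF: "sum g (window k lo (n0 + m)) = transfer w (n0 + m) False" for m
  proof -
    have am: "a \<in> window k lo (n0 + m)"
      using a0 window_mono[of lo lo n0 "n0 + m" k] by auto
    show ?thesis
      using sum_strip_kernel_window[OF am, of t y] unfolding g_def w_def f_def .
  qed
  have "(\<lambda>m. (1 - y * t ^ k - transfer w (n0 + m) True) / (1 - y)) \<longlonglongrightarrow> (1 - y * t ^ k - 0) / (1 - y)"
    using y by (intro tendsto_intros T0) auto
  then have lim: "(\<lambda>m. sum g (window k lo (n0 + m))) \<longlonglongrightarrow> (1 - y * t ^ k) / (1 - y)"
    unfolding sumF F by simp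
  \<comment> \<open>Windows with fixed left end do not exhaust \<open>Sig k\<close>, but they do
    exhaust the strips above \<open>a\<close>, whose parts never drop below lo.\<close>
  have "(g has_sum (1 - y * t ^ k) / (1 - y)) {b \<in> Sig k. prec_Q k a b}"
  proof (rule nn_has_sum_exhaustion)
    show "(\<lambda>m. sum g {b \<in> window k lo (n0 + m). prec_Q k a b}) \<longlonglongrightarrow> (1 - y * t ^ k) / (1 - y)"
    proof -
      have "sum g {b \<in> window k lo (n0 + m). prec_Q k a b} = sum g (window k lo (n0 + m))" for m
        by (rule sum.mono_neutral_left) (auto simp: finite_window g_def strip_weight_def)
      then show ?thesis
        using lim by simp
    qed
    show "0 \<le> g x" for x
      unfolding g_def using t y by (intro mult_nonneg_nonneg strip_weight_nonneg) auto
    show "\<forall>\<^sub>F n in sequentially. X \<subseteq> {b \<in> window k lo (n0 + n). prec_Q k a b}"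
      if X: "finite X" "X \<subseteq> {b \<in> Sig k. prec_Q k a b}" for X
    proof -
      obtain lo1 n1 where X1: "X \<subseteq> window k lo1 n1"
        using ex_window[of X k] X by auto
      have "X \<subseteq> {b \<in> window k lo (n0 + n). prec_Q k a b}" if n: "nat (lo1 + int n1 - lo) \<le> n" for n
      proof
        fix b assume bX: "b \<in> X"
        then have b: "b \<in> Sig k" "prec_Q k a b" "b \<in> window k lo1 n1"
          using X X1 by auto
        have "lo \<le> b ! i \<and> b ! i < lo + int (n0 + n)" if i: "i < k" for i
        proof -
          have "lo \<le> a ! i" "a ! i \<le> b ! i" "b ! i < lo1 + int n1"
            using i a0 window_iff[OF a] b(2) window_iff[OF b(1)] b(3) by (auto simp: prec_Q_def)
          then show ?thesis
            using n by linarith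
        qed
        then show "b \<in> {b \<in> window k lo (n0 + n). prec_Q k a b}"
          using b window_iff[OF b(1)] by simp
      qed
      then show ?thesis
        unfolding eventually_sequentially by blast
    qed
  qed (auto simp: finite_window dest: window_Sig)
  then show ?thesis
    unfolding g_def by (subst has_sum_cong_neutral[where T = "{b \<in> Sig k. prec_Q k a b}"]) (auto simp: strip_weight_def)
qed

section \<open>Principal specialization and the passage from phi to psi\<close>

lemma permutes_no_descent_step_eq_id:
  assumes p: "\<sigma> permutes {..<k::nat}" and nd: "\<And>i j. i < j \<Longrightarrow> j < k \<Longrightarrow> \<sigma> i \<noteq> Suc (\<sigma> j)"
  shows "\<sigma> = id"
proof -
  define \<rho> where "\<rho> = inv \<sigma>"
  have \<rho>: "\<rho> permutes {..<k}"
    using p by (simp add: \<rho>_def permutes_inv)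
  have inv: "\<sigma> (\<rho> m) = m" for m
    using permutes_inverses(1)[OF p] by (simp add: \<rho>_def)
  \<comment> \<open>No value \<open>Suc m\<close> stands before m, so the inverse is increasing and
    must be the identity.\<close>
  have step: "\<rho> m < \<rho> (Suc m)" if "Suc m < k" for m
  proof (rule ccontr)
    assume "\<not> ?thesis"
    moreover have "\<rho> m \<noteq> \<rho> (Suc m)"
      using inv[of m] inv[of "Suc m"] by (metis n_not_Suc_n)
    ultimately have "\<rho> (Suc m) < \<rho> m"
      by simp
    moreover have "\<rho> m < k"
      using permutes_in_image[OF \<rho>, of m] that by simp
    ultimately show False
      using nd[of "\<rho> (Suc m)" "\<rho> m"] by (simp add: inv)
  qed
  have "m \<le> \<rho> m" if "m < k" for m
    using that
  proof (induction m)
    case (Suc m)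
    then show ?case
      using step[of m] by simp
  qed simp
  then have "\<rho> = id"
    using \<rho> by (intro permutes_natset_ge) auto
  then show ?thesis
    using p by (metis \<rho>_def inv_id permutes_inv_inv)
qed

text \<open>Macdonald's b_\<lambda>(t), the ratio of Q to P, taken over all integer values of the
  parts.\<close>

definition qpoch_mult :: "real \<Rightarrow> int list \<Rightarrow> real" where
  "qpoch_mult t a = (\<Prod>x\<in>set a. qpoch t t (count_list a x))"

definition principal_const :: "nat \<Rightarrow> real \<Rightarrow> real" where
  "principal_const k t = (1 - t) ^ k * (\<Prod>(i, j) \<in> {(i, j). i < j \<and> j < k}. (t ^ i - t * t ^ j) / (t ^ i - t ^ j))"

lemma qpoch_pos: "0 < t \<Longrightarrow> t < 1 \<Longrightarrow> 0 < qpoch t t m"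
  unfolding qpoch_def by (intro prod_pos) (auto simp: power_Suc[symmetric] simp del: power_Suc intro!: power_less_one_iff[THEN iffD2])

lemma qpoch_mult_pos: "0 < t \<Longrightarrow> t < 1 \<Longrightarrow> 0 < qpoch_mult t a"
  unfolding qpoch_mult_def by (intro prod_pos) (auto simp: qpoch_pos)

lemma principal_const_pos:
  assumes t: "0 < t" "t < 1"
  shows "0 < principal_const k t"
proof -
  have "0 < (t ^ i - t * t ^ j) / (t ^ i - t ^ j)" if "i < j" for i j
  proof -
    have "t ^ j < t ^ i" "t ^ Suc j < t ^ i"
      using t that by (auto intro!: power_strict_decreasing simp del: power_Suc)
    then show ?thesis
      by simp
  qed
  then show ?thesis
    unfolding principal_const_def using t by (auto intro!: mult_pos_pos prod_pos)
qed

text \<open>At \<open>x = (1, t, \<dots>, t ^ (k - 1))\<close> the product over \<open>i < j\<close> contains a vanishing factor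
  \<open>x (\<sigma> i) - t * x (\<sigma> j)\<close> unless \<open>\<sigma>\<close> is the identity.\<close>

lemma hl_P_principal:
  assumes t: "0 < t" "t < 1" and a: "a \<in> Sig k"
  shows "hl_P k t a (\<lambda>i. t ^ i) = principal_const k t * t powi nstat a / qpoch_mult t a"
proof -
  let ?D = "\<lambda>\<sigma>. \<Prod>(i, j) \<in> {(i, j). i < j \<and> j < k}. (t ^ \<sigma> i - t * t ^ \<sigma> j) / (t ^ \<sigma> i - t ^ \<sigma> j)"
  let ?N = "\<lambda>\<sigma>. \<Prod>i<k. (t ^ \<sigma> i) powi (a ! i)"
  have fin: "finite {(i, j). i < j \<and> j < (k::nat)}"
    by (rule finite_subset[of _ "{..<k} \<times> {..<k}"]) auto
  have zero: "?N \<sigma> * ?D \<sigma> = 0" if "\<sigma> \<in> {\<sigma>. \<sigma> permutes {..<k}} - {id}" for \<sigma>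
  proof -
    have "\<exists>i j. i < j \<and> j < k \<and> \<sigma> i = Suc (\<sigma> j)"
      using permutes_no_descent_step_eq_id[of \<sigma> k] that by auto
    then obtain i j where "i < j" "j < k" "\<sigma> i = Suc (\<sigma> j)"
      by blast
    then have "?D \<sigma> = 0"
      using fin by (intro prod_zero bexI[of _ "(i, j)"]) auto
    then show ?thesis
      by simp
  qed
  have N: "?N id = t powi nstat a"
  proof -
    have "(\<Prod>i<m. (t ^ i) powi (a ! i)) = t powi (\<Sum>i<m. int i * a ! i)" for m
      by (induction m) (use t in \<open>auto simp: power_int_add power_int_mult\<close>)
    then show ?thesis
      by (simp add: nstat_def length_Sig[OF a])
  qed
  have "(\<Sum>\<sigma> | \<sigma> permutes {..<k}. ?N \<sigma> * ?D \<sigma>) = (\<Sum>\<sigma>\<in>{id}. ?N \<sigma> * ?D \<sigma>)"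
    by (rule sum.mono_neutral_right) (auto simp: finite_permutations zero)
  then have S: "(\<Sum>\<sigma> | \<sigma> permutes {..<k}. ?N \<sigma> * ?D \<sigma>) = t powi nstat a * ?D id"
    using N by simp
  have "hl_v t a = qpoch_mult t a / (1 - t) ^ k"
    unfolding hl_v_def qpoch_mult_def
    by (simp add: prod_dividef power_sum[symmetric] sum_count_set length_Sig[OF a])
  then show ?thesis
    unfolding hl_P_def S principal_const_def by simp
qed

lemma hl_P_principal_pos:
  assumes t: "0 < t" "t < 1" and a: "a \<in> Sig k"
  shows "0 < hl_P k t a (\<lambda>i. t ^ i)"
  unfolding hl_P_principal[OF assms] using t by (simp add: principal_const_pos qpoch_mult_pos)

text \<open>The identity phi / psi = b_b / b_a: multiplicities change by at most one at each site,
  and (t;t) gains the factor \<open>1 - t ^ Suc m\<close> from m to \<open>Suc m\<close>.\<close>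

lemma hl_phi_gauge:
  assumes a: "a \<in> window k lo n" and b: "b \<in> window k lo n" and ab: "prec_Q k a b"
  shows "hl_phi t b a * qpoch_mult t a = hl_phi t a b * qpoch_mult t b"
proof -
  have phi: "hl_phi t u v = (\<Prod>i<n. if count_list u (lo + int i) = count_list v (lo + int i) + 1
      then 1 - t ^ count_list u (lo + int i) else 1)" if u: "u \<in> window k lo n" for u v
  proof -
    have "{x. count_list u x = count_list v x + 1} = {x. x \<in> set u \<and> count_list u x = count_list v x + 1}"
      using count_notin by fastforce
    then have "hl_phi t u v = (\<Prod>i<n. if lo + int i \<in> set u \<and> count_list u (lo + int i) = count_list v (lo + int i) + 1
      then 1 - t ^ count_list u (lo + int i) else 1)"
      using prod_window_count[OF u, where Q = "\<lambda>x. count_list u x = count_list v x + 1" and g = "\<lambda>x. 1 - t ^ count_list u x"]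
      by (simp add: hl_phi_def)
    also have "\<dots> = (\<Prod>i<n. if count_list u (lo + int i) = count_list v (lo + int i) + 1
      then 1 - t ^ count_list u (lo + int i) else 1)"
      using count_notin by (intro prod.cong) fastforce+
    finally show ?thesis .
  qed
  have qp: "qpoch_mult t u = (\<Prod>i<n. qpoch t t (count_list u (lo + int i)))" if u: "u \<in> window k lo n" for u
    using prod_window_count[OF u, where Q = "\<lambda>_. True" and g = "\<lambda>x. qpoch t t (count_list u x)"]
    by (auto simp: qpoch_mult_def qpoch_def count_notin intro!: prod.cong)
  have qS: "qpoch t t (Suc m) = qpoch t t m * (1 - t ^ Suc m)" for m
    by (simp add: qpoch_def)
  show ?thesis
    unfolding phi[OF a] phi[OF b] qp[OF a] qp[OF b] prod.distrib[symmetric]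
  proof (rule prod.cong[OF refl])
    fix i assume "i \<in> {..<n}"
    then have "count_list a (lo + int i) + of_bool (i \<in> strip_edges lo n a b)
        = count_list b (lo + int i) + of_bool (Suc i \<in> strip_edges lo n a b)"
      by (intro count_list_strip[OF a b ab]) simp
    then consider "count_list a (lo + int i) = count_list b (lo + int i)"
      | "count_list a (lo + int i) = Suc (count_list b (lo + int i))"
      | "count_list b (lo + int i) = Suc (count_list a (lo + int i))"
      by (auto simp: of_bool_def split: if_splits)
    then show "(if count_list b (lo + int i) = count_list a (lo + int i) + 1
          then 1 - t ^ count_list b (lo + int i) else 1) * qpoch t t (count_list a (lo + int i))
      = (if count_list a (lo + int i) = count_list b (lo + int i) + 1
          then 1 - t ^ count_list a (lo + int i) else 1) * qpoch t t (count_list b (lo + int i))"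
      by cases (simp_all add: qS mult.commute)
  qed
qed

lemma Q_chains_1: "la \<in> Sig k \<Longrightarrow> nu \<in> Sig k \<Longrightarrow> Q_chains k 1 nu la = (if prec_Q k la nu then {[la, nu]} else {})"
  by (auto simp: Q_chains_def length_Suc_conv)

lemma hl_Q_one:
  assumes "la \<in> Sig k" "nu \<in> Sig k"
  shows "hl_Q k t nu la 1 y = (if prec_Q k la nu then y 0 powi (sum_list nu - sum_list la) * hl_phi t nu la else 0)"
  unfolding hl_Q_def Q_chains_1[OF assms] by simp

text \<open>The ratio of P-values contributes a power of t and b_a / b_b; the latter exchanges phi
  for psi.\<close>

lemma Pieri_weight_principal:
  assumes t: "0 < t" "t < 1" and a: "a \<in> Sig k" and b: "b \<in> Sig k"
  shows "hl_Q k t b a 1 (\<lambda>_. y) * (hl_P k t b (\<lambda>i. t ^ i) / hl_P k t a (\<lambda>i. t ^ i))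
    = strip_weight k t y a b * t powi (nstat b - nstat a)"
proof (cases "prec_Q k a b")
  case True
  obtain lo n where w: "a \<in> window k lo n" "b \<in> window k lo n"
    using ex_window[of "{a, b}" k] a b by auto
  have pos: "principal_const k t > 0" "qpoch_mult t a > 0" "qpoch_mult t b > 0"
    using t by (auto simp: principal_const_pos qpoch_mult_pos)
  have "hl_phi t b a * (hl_P k t b (\<lambda>i. t ^ i) / hl_P k t a (\<lambda>i. t ^ i))
      = (hl_phi t b a * qpoch_mult t a) * (t powi nstat b / t powi nstat a) / qpoch_mult t b"
    unfolding hl_P_principal[OF t a] hl_P_principal[OF t b] using pos by (simp add: field_simps)
  also have "\<dots> = hl_phi t a b * t powi (nstat b - nstat a)"
    unfolding hl_phi_gauge[OF w True] using pos t by (simp add: power_int_diff)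
  finally have "hl_phi t b a * (hl_P k t b (\<lambda>i. t ^ i) / hl_P k t a (\<lambda>i. t ^ i))
      = hl_phi t a b * t powi (nstat b - nstat a)" .
  then show ?thesis
    using True unfolding hl_Q_one[OF a b] strip_weight_def by (simp only: if_True mult.assoc)
qed (simp add: strip_weight_def hl_Q_one[OF a b, unfolded One_nat_def])

section \<open>The graded graph\<close>

lemma prod_principal_telescope:
  fixes t :: real
  assumes t: "0 < t" "t < 1" and n: "1 \<le> n"
  shows "(\<Prod>i<k. (1 - t * t ^ i * t ^ n) / (1 - t ^ i * t ^ n)) = (1 - t ^ (n + k)) / (1 - t ^ n)"
proof (induction k)
  case 0
  have "t ^ n < 1"
    using t n by (simp add: power_less_one_iff)
  then show ?case by simp
next
  case (Suc k)
  have "t ^ (n + k) < 1"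
    using t n by (simp add: power_less_one_iff)
  moreover have "1 - t ^ k * t ^ n = 1 - t ^ (n + k)" "1 - t * t ^ k * t ^ n = 1 - t ^ (n + Suc k)"
    by (simp_all add: power_add)
  ultimately show ?case
    unfolding prod.lessThan_Suc Suc.IH by simp
qed

lemma Pi_fin_principal_one:
  assumes "0 < t" "t < 1" "1 \<le> n"
  shows "Pi_fin t k (\<lambda>i. t ^ i) 1 (\<lambda>_. t ^ n) = (1 - t ^ (n + k)) / (1 - t ^ n)"
  using prod_principal_telescope[OF assms, of k] by (simp add: Pi_fin_def)

lemma Pi_fin_Suc: "Pi_fin t a x (Suc J) y = Pi_fin t a x J y * Pi_fin t a x 1 (\<lambda>_. y J)"
  unfolding Pi_fin_def prod.lessThan_Suc prod.distrib by simp

lemma Pi_fin_tendsto_Pi_inf: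
  assumes t: "0 < t" "t < 1" and n: "1 \<le> n"
  shows "(\<lambda>J. Pi_fin t k (\<lambda>i. t ^ i) J (\<lambda>j. t ^ (n + j))) \<longlonglongrightarrow> Pi_inf t k (\<lambda>i. t ^ i) (\<lambda>j. t ^ (n + j))"
    and "Pi_inf t k (\<lambda>i. t ^ i) (\<lambda>j. t ^ (n + j)) > 0"
proof -
  define f where "f i j = (1 - t * t ^ i * t ^ (n + j)) / (1 - t ^ i * t ^ (n + j))" for i j
  have P: "(\<lambda>J. \<Prod>j<J. f i j) \<longlonglongrightarrow> prodinf (f i)" and pos: "prodinf (f i) > 0" for i
  proof -
    have n': "1 \<le> n + i"
      using n by simp
    \<comment> \<open>The factors depend on i + j only, so the telescoping over i also works over j,
      with \<open>n + i\<close> in place of n.\<close>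
    have "(\<Prod>j<J. f i j) = (\<Prod>j<J. (1 - t * t ^ j * t ^ (n + i)) / (1 - t ^ j * t ^ (n + i)))" for J
      unfolding f_def by (rule prod.cong) (simp_all add: power_add mult_ac)
    then have eq: "(\<Prod>j<J. f i j) = (1 - t ^ (n + i + J)) / (1 - t ^ (n + i))" for J
      using prod_principal_telescope[OF t n', of J] by simp
    have lt: "t ^ (n + i) < 1"
      using t n by (simp add: power_less_one_iff)
    have "(\<lambda>J. (1 - t ^ (n + i) * t ^ J) / (1 - t ^ (n + i))) \<longlonglongrightarrow> (1 - t ^ (n + i) * 0) / (1 - t ^ (n + i))"
      using t lt by (intro tendsto_intros LIMSEQ_power_zero) auto
    then have lim: "(\<lambda>J. \<Prod>j<J. f i j) \<longlonglongrightarrow> 1 / (1 - t ^ (n + i))"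
      unfolding eq by (simp add: power_add)
    then have "(\<lambda>J. \<Prod>j\<le>J. f i j) \<longlonglongrightarrow> 1 / (1 - t ^ (n + i))"
      unfolding lessThan_Suc_atMost[symmetric] by (rule LIMSEQ_Suc)
    then have "f i has_prod (1 / (1 - t ^ (n + i)))"
      using lt by (simp add: has_prod_def raw_has_prod_def)
    then have "prodinf (f i) = 1 / (1 - t ^ (n + i))"
      by (simp add: has_prod_iff)
    then show "(\<lambda>J. \<Prod>j<J. f i j) \<longlonglongrightarrow> prodinf (f i)" "prodinf (f i) > 0"
      using lim lt by simp_all
  qed
  have inf: "Pi_inf t k (\<lambda>i. t ^ i) (\<lambda>j. t ^ (n + j)) = (\<Prod>i<k. prodinf (f i))"
    by (simp add: Pi_inf_def f_def[abs_def])
  have fin: "Pi_fin t k (\<lambda>i. t ^ i) J (\<lambda>j. t ^ (n + j)) = (\<Prod>i<k. \<Prod>j<J. f i j)" for J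
    by (simp add: Pi_fin_def f_def)
  show "(\<lambda>J. Pi_fin t k (\<lambda>i. t ^ i) J (\<lambda>j. t ^ (n + j))) \<longlonglongrightarrow> Pi_inf t k (\<lambda>i. t ^ i) (\<lambda>j. t ^ (n + j))"
    unfolding inf fin by (intro tendsto_prod P)
  show "Pi_inf t k (\<lambda>i. t ^ i) (\<lambda>j. t ^ (n + j)) > 0"
    unfolding inf by (intro prod_pos) (simp add: pos)
qed

section \<open>Negation of signatures and chains of strips\<close>

lemma neg_sig_neg_sig [simp]: "neg_sig (neg_sig a) = a"
  by (simp add: neg_sig_def rev_map comp_def)

lemma neg_sig_Sig: "a \<in> Sig k \<Longrightarrow> neg_sig a \<in> Sig k"
  by (auto simp: Sig_def neg_sig_def sorted_wrt_rev sorted_wrt_map)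

lemma bij_betw_neg_sig: "bij_betw neg_sig (Sig k) (Sig k)"
  by (rule bij_betw_byWitness[where f' = neg_sig]) (auto simp: neg_sig_Sig)

lemma window_between:
  assumes a: "a \<in> window k lo n" and c: "c \<in> window k lo n" and b: "b \<in> Sig k"
    and "\<And>i. i < k \<Longrightarrow> a ! i \<le> b ! i \<and> b ! i \<le> c ! i"
  shows "b \<in> window k lo n"
  using assms(4) a c window_iff[OF window_Sig[OF a]] window_iff[OF window_Sig[OF c]] window_iff[OF b]
  by (meson order_le_less_trans order_trans)

lemma prec_Q_Sig: "prec_Q k a b \<Longrightarrow> a \<in> Sig k" "prec_Q k a b \<Longrightarrow> b \<in> Sig k"
  by (simp_all add: prec_Q_def)

lemma prec_Q_nth: "prec_Q k a b \<Longrightarrow> i < k \<Longrightarrow> a ! i \<le> b ! i"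
  by (simp add: prec_Q_def)

lemma Q_chains_nth_mono:
  assumes c: "c \<in> Q_chains k J nu la" and i: "i < k"
  shows "la ! i \<le> nu ! i"
proof -
  have "la ! i \<le> c ! p ! i" if "p \<le> J" for p
    using that
  proof (induction p)
    case 0
    then show ?case using c by (simp add: Q_chains_def)
  next
    case (Suc p)
    then have "prec_Q k (c ! p) (c ! Suc p)"
      using c by (simp add: Q_chains_def)
    then show ?case
      using Suc prec_Q_nth[of k "c ! p" "c ! Suc p" i] i by simp
  qed
  from this[of J] show ?thesis
    using c by (simp add: Q_chains_def)
qed

lemma hl_Q_nonzero_nth:
  assumes "hl_Q k t nu la J y \<noteq> 0" "i < k"
  shows "la ! i \<le> nu ! i"
proof -
  have "Q_chains k J nu la \<noteq> {}"
    using assms(1) by (auto simp: hl_Q_def)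
  then show ?thesis
    using Q_chains_nth_mono assms(2) by blast
qed

lemma hl_Q_0: "la \<in> Sig k \<Longrightarrow> hl_Q k t nu la 0 y = of_bool (nu = la)"
proof -
  assume la: "la \<in> Sig k"
  have "Q_chains k 0 nu la = (if nu = la then {[la]} else {})"
    using la by (auto simp: Q_chains_def length_Suc_conv)
  then show ?thesis
    by (simp add: hl_Q_def)
qed

lemma bij_betw_Q_chains_snoc:
  assumes nu: "nu \<in> Sig k"
    and cover: "\<And>b c. c \<in> Q_chains k J b la \<Longrightarrow> prec_Q k b nu \<Longrightarrow> b \<in> B"
  shows "bij_betw (\<lambda>(b, c). c @ [nu]) (SIGMA b:{b \<in> B. prec_Q k b nu}. Q_chains k J b la) (Q_chains k (Suc J) nu la)"
proof (rule bij_betw_byWitness[where f' = "\<lambda>c. (c ! J, take (Suc J) c)"])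
  show "\<forall>x\<in>SIGMA b:{b \<in> B. prec_Q k b nu}. Q_chains k J b la.
      (\<lambda>c. (c ! J, take (Suc J) c)) ((\<lambda>(b, c). c @ [nu]) x) = x"
    by (auto simp: Q_chains_def nth_append)
  have snoc: "take (Suc J) c @ [nu] = c" if "c \<in> Q_chains k (Suc J) nu la" for c
    using that take_Suc_conv_app_nth[of "Suc J" c] by (simp add: Q_chains_def)
  then show "\<forall>c\<in>Q_chains k (Suc J) nu la. (\<lambda>(b, c). c @ [nu]) ((\<lambda>c. (c ! J, take (Suc J) c)) c) = c"
    by simp
  show "(\<lambda>(b, c). c @ [nu]) ` (SIGMA b:{b \<in> B. prec_Q k b nu}. Q_chains k J b la) \<subseteq> Q_chains k (Suc J) nu la"
  proof
    fix x assume "x \<in> (\<lambda>(b, c). c @ [nu]) ` (SIGMA b:{b \<in> B. prec_Q k b nu}. Q_chains k J b la)"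
    then obtain b c where b: "prec_Q k b nu" and c: "c \<in> Q_chains k J b la" and x: "x = c @ [nu]"
      by auto
    have "prec_Q k ((c @ [nu]) ! i) ((c @ [nu]) ! Suc i)" if "i < Suc J" for i
      using that b c by (cases "i = J") (auto simp: Q_chains_def nth_append)
    then show "x \<in> Q_chains k (Suc J) nu la"
      unfolding x using c nu by (auto simp: Q_chains_def nth_append)
  qed
  show "(\<lambda>c. (c ! J, take (Suc J) c)) ` Q_chains k (Suc J) nu la \<subseteq> (SIGMA b:{b \<in> B. prec_Q k b nu}. Q_chains k J b la)"
  proof
    fix x assume "x \<in> (\<lambda>c. (c ! J, take (Suc J) c)) ` Q_chains k (Suc J) nu la"
    then obtain c where c: "c \<in> Q_chains k (Suc J) nu la" and x: "x = (c ! J, take (Suc J) c)"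
      by blast
    have p: "prec_Q k (c ! J) nu"
      using c by (auto simp: Q_chains_def)
    have "set (take (Suc J) c) \<subseteq> Sig k"
      using c set_take_subset[of "Suc J" c] by (auto simp: Q_chains_def)
    then have "take (Suc J) c \<in> Q_chains k J (c ! J) la"
      using c by (auto simp: Q_chains_def)
    with p cover show "x \<in> (SIGMA b:{b \<in> B. prec_Q k b nu}. Q_chains k J b la)"
      unfolding x by blast
  qed
qed

text \<open>Splits off the last variable. The set \<open>B\<close> is left open so that a finite
  window can index the intermediate signatures.\<close>

lemma hl_Q_Suc:
  assumes nu: "nu \<in> Sig k" and B: "finite B"
    and cover: "\<And>b c. c \<in> Q_chains k J b la \<Longrightarrow> prec_Q k b nu \<Longrightarrow> b \<in> B" and BS: "B \<subseteq> Sig k"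
  shows "hl_Q k t nu la (Suc J) y = (\<Sum>b\<in>B. hl_Q k t b la J y * hl_Q k t nu b 1 (\<lambda>_. y J))"
proof -
  let ?g = "\<lambda>i c. y i powi (sum_list (c ! Suc i) - sum_list (c ! i)) * hl_phi t (c ! Suc i) (c ! i)"
  have "hl_Q k t nu la (Suc J) y
      = (\<Sum>(b, c)\<in>(SIGMA b:{b \<in> B. prec_Q k b nu}. Q_chains k J b la). \<Prod>i<Suc J. ?g i (c @ [nu]))"
    unfolding hl_Q_def
    by (subst sum.reindex_bij_betw[OF bij_betw_Q_chains_snoc[OF nu cover], symmetric])
      (auto intro!: sum.cong)
  also have "\<dots> = (\<Sum>(b, c)\<in>(SIGMA b:{b \<in> B. prec_Q k b nu}. Q_chains k J b la).
      (\<Prod>i<J. ?g i c) * (y J powi (sum_list nu - sum_list b) * hl_phi t nu b))"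
  proof (intro sum.cong refl, clarify)
    fix b c assume c: "c \<in> Q_chains k J b la"
    have "(\<Prod>i<J. ?g i (c @ [nu])) = (\<Prod>i<J. ?g i c)"
      using c by (intro prod.cong refl) (simp add: Q_chains_def nth_append)
    moreover have "(c @ [nu]) ! Suc J = nu" "(c @ [nu]) ! J = b"
      using c by (auto simp: Q_chains_def nth_append)
    ultimately show "(\<Prod>i<Suc J. ?g i (c @ [nu])) = (\<Prod>i<J. ?g i c) * (y J powi (sum_list nu - sum_list b) * hl_phi t nu b)"
      by simp
  qed
  also have "\<dots> = (\<Sum>b | b \<in> B \<and> prec_Q k b nu. hl_Q k t b la J y * (y J powi (sum_list nu - sum_list b) * hl_phi t nu b))"
    using B by (subst sum.Sigma[symmetric]) (auto simp: finite_Q_chains hl_Q_def sum_distrib_right)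
  also have "\<dots> = (\<Sum>b\<in>B. hl_Q k t b la J y *
      (if prec_Q k b nu then y J powi (sum_list nu - sum_list b) * hl_phi t nu b else 0))"
    using B by (intro sum.mono_neutral_cong_left) auto
  also have "\<dots> = (\<Sum>b\<in>B. hl_Q k t b la J y * hl_Q k t nu b 1 (\<lambda>_. y J))"
    by (intro sum.cong refl, subst hl_Q_one[OF _ nu]) (use BS in auto)
  finally show ?thesis .
qed

section \<open>The cotransition kernels as freezing kernels\<close>

locale hl_graph =
  fixes k :: nat and t :: real
  assumes t_pos: "0 < t" and t_less_1: "t < 1"
begin

abbreviation P :: "int list \<Rightarrow> real" where
  "P a \<equiv> hl_P k t a (\<lambda>i. t ^ i)"

lemma t_power: "1 \<le> n \<Longrightarrow> 0 < t ^ n" "1 \<le> n \<Longrightarrow> t ^ n < 1"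
  using t_pos t_less_1 by (auto simp: power_less_one_iff)

lemma P_pos: "a \<in> Sig k \<Longrightarrow> 0 < P a"
  using hl_P_principal_pos[OF t_pos t_less_1] .

lemma cotrans_eq:
  assumes n: "1 \<le> n" and nu: "nu \<in> Sig k" and la: "la \<in> Sig k"
  shows "cotrans k t n nu la = strip_weight k t (t ^ n) (neg_sig nu) (neg_sig la) *
    t powi (nstat (neg_sig la) - nstat (neg_sig nu)) * ((1 - t ^ n) / (1 - t ^ (n + k)))"
  unfolding cotrans_def Pi_fin_principal_one[OF t_pos t_less_1 n]
    Pieri_weight_principal[OF t_pos t_less_1 neg_sig_Sig[OF nu] neg_sig_Sig[OF la], symmetric]
  by simp

lemma cotrans_nonneg:
  assumes n: "1 \<le> n" and nu: "nu \<in> Sig k" and la: "la \<in> Sig k"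
  shows "0 \<le> cotrans k t n nu la"
  unfolding cotrans_eq[OF assms] using t_pos t_less_1 t_power[OF n] t_power[of "n + k"] n
  by (auto intro!: mult_nonneg_nonneg divide_nonneg_nonneg strip_weight_nonneg)

lemma cotrans_has_sum:
  assumes n: "1 \<le> n" and nu: "nu \<in> Sig k"
  shows "((\<lambda>la. cotrans k t n nu la) has_sum 1) (Sig k)"
proof -
  let ?C = "(1 - t ^ n) / (1 - t ^ (n + k))"
  let ?g = "\<lambda>b. strip_weight k t (t ^ n) (neg_sig nu) b * t powi (nstat b - nstat (neg_sig nu)) * ?C"
  have "(?g has_sum ((1 - t ^ n * t ^ k) / (1 - t ^ n)) * ?C) (Sig k)"
    by (rule has_sum_cmult_left, rule strip_kernel_has_sum)
      (use t_pos t_less_1 t_power[OF n] neg_sig_Sig[OF nu] in auto)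
  moreover have "((1 - t ^ n * t ^ k) / (1 - t ^ n)) * ?C = 1"
    using t_power[OF n] t_power[of "n + k"] n by (simp add: power_add)
  ultimately have "(?g has_sum 1) (Sig k)"
    by simp
  then have "((\<lambda>la. ?g (neg_sig la)) has_sum 1) (Sig k)"
    by (subst has_sum_reindex_bij_betw[OF bij_betw_neg_sig])
  then show ?thesis
    by (subst has_sum_cong) (auto simp: cotrans_eq[OF n nu])
qed

text \<open>The identity kernel is a default at level 0 and outside \<open>Sig k\<close>; with it
  the freezing bound holds for all arguments.\<close>

definition kernel :: "nat \<Rightarrow> int list \<Rightarrow> int list pmf" where
  "kernel n nu = (if 1 \<le> n \<and> nu \<in> Sig k
     then SOME p. set_pmf p \<subseteq> Sig k \<and> (\<forall>la\<in>Sig k. pmf p la = cotrans k t n nu la)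
     else return_pmf nu)"

lemma kernel_props:
  assumes "1 \<le> n" "nu \<in> Sig k"
  shows "set_pmf (kernel n nu) \<subseteq> Sig k \<and> (\<forall>la\<in>Sig k. pmf (kernel n nu) la = cotrans k t n nu la)"
proof -
  have "\<exists>p. set_pmf p \<subseteq> Sig k \<and> (\<forall>la\<in>Sig k. pmf p la = cotrans k t n nu la)"
    using pmf_of_has_sum[OF cotrans_nonneg[OF assms] cotrans_has_sum[OF assms]] by metis
  from someI_ex[OF this] show ?thesis
    using assms by (simp add: kernel_def)
qed

lemma set_kernel: "nu \<in> Sig k \<Longrightarrow> set_pmf (kernel n nu) \<subseteq> Sig k"
  using kernel_props[of n nu] by (cases "1 \<le> n") (auto simp: kernel_def)

lemma pmf_kernel: "1 \<le> n \<Longrightarrow> nu \<in> Sig k \<Longrightarrow> la \<in> Sig k \<Longrightarrow> pmf (kernel n nu) la = cotrans k t n nu la"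
  using kernel_props by blast

lemma cotrans_self:
  assumes n: "1 \<le> n" and nu: "nu \<in> Sig k"
  shows "cotrans k t n nu nu = (1 - t ^ n) / (1 - t ^ (n + k))"
proof -
  have "prec_Q k (neg_sig nu) (neg_sig nu)"
    using neg_sig_Sig[OF nu] by (simp add: prec_Q_iff_profile)
  then have "strip_weight k t (t ^ n) (neg_sig nu) (neg_sig nu) = 1"
    by (simp add: strip_weight_def hl_phi_def)
  then show ?thesis
    by (simp add: cotrans_eq[OF n nu nu])
qed

text \<open>\<open>t ^ n / (1 - t)\<close> is the tail of the geometric series of the
  \<open>t ^ m\<close>, and \<open>t ^ n\<close> bounds the probability of moving at level
  n.\<close>

sublocale freezing_kernels kernel "\<lambda>n. t ^ n / (1 - t)"
proof
  fix n x
  have "t ^ n / (1 - t) - t ^ Suc n / (1 - t) = t ^ n * (1 - t) / (1 - t)"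
    unfolding diff_divide_distrib[symmetric] by (simp add: algebra_simps)
  then have tau: "t ^ n / (1 - t) - t ^ Suc n / (1 - t) = t ^ n"
    using t_less_1 by simp
  show "1 - pmf (kernel n x) x \<le> t ^ n / (1 - t) - t ^ Suc n / (1 - t)"
  proof (cases "1 \<le> n \<and> x \<in> Sig k")
    case True
    have y: "0 < t ^ n" "t ^ n < 1" "0 < t ^ (n + k)" "t ^ (n + k) < 1"
      using True t_power[of n] t_power[of "n + k"] by auto
    then have "(1 - t ^ n) * (1 - t ^ (n + k)) \<le> 1 - t ^ n"
      by (intro mult_left_le) auto
    then have "1 - t ^ n \<le> (1 - t ^ n) / (1 - t ^ (n + k))"
      using y by (subst pos_le_divide_eq) auto
    then show ?thesis
      unfolding tau using True by (simp add: pmf_kernel cotrans_self)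
  next
    case False
    then have "kernel n x = return_pmf x"
      unfolding kernel_def by (rule if_not_P)
    then show ?thesis
      unfolding tau using t_pos by simp
  qed
next
  have "(\<lambda>n. t ^ n / (1 - t)) \<longlonglongrightarrow> 0 / (1 - t)"
    using t_pos t_less_1 by (intro tendsto_intros LIMSEQ_power_zero) auto
  then show "(\<lambda>n. t ^ n / (1 - t)) \<longlonglongrightarrow> 0"
    by simp
qed

text \<open>The defining sums test targets in \<open>Sig k\<close> only; outside it both laws
  vanish, so they amount to an equality of laws.\<close>

lemma coherent_systems_eq: "coherent_systems k t = systems (Sig k)"
proof -
  have iff: "(\<forall>la\<in>Sig k. ((\<lambda>nu. pmf (M (n + 1)) nu * cotrans k t n nu la) has_sum pmf (M n) la) (Sig k))
      \<longleftrightarrow> M n = bind_pmf (M (Suc n)) (kernel n)"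
    if M: "M \<in> {1..} \<rightarrow>\<^sub>E {p. set_pmf p \<subseteq> Sig k}" and n: "1 \<le> n" for M n
  proof -
    have sub: "set_pmf (M n) \<subseteq> Sig k" "set_pmf (M (Suc n)) \<subseteq> Sig k"
      using M n by (auto simp: PiE_def Pi_def)
    have hs: "((\<lambda>nu. pmf (M (n + 1)) nu * cotrans k t n nu la)
        has_sum pmf (bind_pmf (M (Suc n)) (kernel n)) la) (Sig k)" if la: "la \<in> Sig k" for la
    proof -
      have "((\<lambda>nu. pmf (M (Suc n)) nu * pmf (kernel n nu) la)
          has_sum pmf (bind_pmf (M (Suc n)) (kernel n)) la) (Sig k)"
        unfolding pmf_bind by (rule expectation_has_sum[where C = 1]) (auto simp: pmf_le_1 sub)
      then show ?thesis
        by (subst has_sum_cong) (auto simp: pmf_kernel[OF n _ la])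
    qed
    have out: "pmf (M n) la = 0" "pmf (bind_pmf (M (Suc n)) (kernel n)) la = 0" if "la \<notin> Sig k" for la
      using that sub set_kernel by (auto simp: pmf_eq_0_set_pmf set_bind_pmf) blast
    show ?thesis
    proof
      assume *: "\<forall>la\<in>Sig k. ((\<lambda>nu. pmf (M (n + 1)) nu * cotrans k t n nu la) has_sum pmf (M n) la) (Sig k)"
      show "M n = bind_pmf (M (Suc n)) (kernel n)"
      proof (rule pmf_eqI)
        fix la
        show "pmf (M n) la = pmf (bind_pmf (M (Suc n)) (kernel n)) la"
          using * hs[of la] out[of la] by (cases "la \<in> Sig k") (auto intro: has_sum_unique)
      qed
    next
      assume "M n = bind_pmf (M (Suc n)) (kernel n)"
      then show "\<forall>la\<in>Sig k. ((\<lambda>nu. pmf (M (n + 1)) nu * cotrans k t n nu la) has_sum pmf (M n) la) (Sig k)"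
        using hs by metis
    qed
  qed
  then show ?thesis
    unfolding coherent_systems_def systems_def coherent_def by blast
qed

lemma boundary_eq: "boundary k t = extreme_systems (Sig k)"
  unfolding boundary_def extreme_systems_def coherent_systems_eq ..

lemma cotrans_nonzero_prec:
  assumes "1 \<le> n" "nu \<in> Sig k" "la \<in> Sig k" "cotrans k t n nu la \<noteq> 0"
  shows "prec_Q k (neg_sig nu) (neg_sig la)"
  using assms(4) unfolding cotrans_eq[OF assms(1-3)] by (auto simp: strip_weight_def split: if_splits)

section \<open>Commuting kernels and explicit laws\<close>

lemma pmf_bind_kernel:
  assumes p: "set_pmf p \<subseteq> Sig k" and m: "1 \<le> m" and la: "la \<in> Sig k" and laW: "neg_sig la \<in> window k lo N"
    and a: "a \<in> window k lo N"
    and below: "\<And>b i. b \<in> set_pmf p \<Longrightarrow> i < k \<Longrightarrow> a ! i \<le> neg_sig b ! i"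
  shows "pmf (bind_pmf p (kernel m)) la
    = (\<Sum>b\<in>window k lo N. pmf p (neg_sig b) * cotrans k t m (neg_sig b) la)"
proof -
  have "pmf (bind_pmf p (kernel m)) la = (\<Sum>b\<in>neg_sig ` window k lo N. pmf (kernel m b) la * pmf p b)"
    unfolding pmf_bind
  proof (rule integral_measure_pmf_real)
    show "finite (neg_sig ` window k lo N)"
      by (simp add: finite_window)
    fix b assume b: "b \<in> set_pmf p" "pmf (kernel m b) la \<noteq> 0"
    then have bS: "b \<in> Sig k"
      using p by auto
    then have "prec_Q k (neg_sig b) (neg_sig la)"
      using b(2) m la by (intro cotrans_nonzero_prec[OF m]) (auto simp: pmf_kernel)
    \<comment> \<open>Interlacing with the target bounds the parts above, the assumption on the
      support bounds them below; hence a finite sum.\<close>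
    then have "neg_sig b \<in> window k lo N"
      by (intro window_between[OF a laW neg_sig_Sig[OF bS]]) (auto simp: prec_Q_nth below[OF b(1)])
    then show "b \<in> neg_sig ` window k lo N"
      by (metis image_eqI neg_sig_neg_sig)
  qed
  also have "\<dots> = (\<Sum>b\<in>window k lo N. pmf (kernel m (neg_sig b)) la * pmf p (neg_sig b))"
    by (subst sum.reindex) (auto intro!: inj_onI dest: arg_cong[of _ _ neg_sig])
  also have "\<dots> = (\<Sum>b\<in>window k lo N. pmf p (neg_sig b) * cotrans k t m (neg_sig b) la)"
    by (intro sum.cong refl) (simp add: pmf_kernel[OF m _ la] neg_sig_Sig window_Sig)
  finally show ?thesis .
qed

text \<open>The powers of t telescope through the intermediate signature and the normalizations
  multiply symmetrically, which leaves \<open>strip_weight_commute\<close>.\<close>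

lemma kernel_commute:
  assumes n: "1 \<le> n" and m: "1 \<le> m" and nu: "nu \<in> Sig k"
  shows "bind_pmf (kernel n nu) (kernel m) = bind_pmf (kernel m nu) (kernel n)"
proof (rule pmf_eqI)
  fix la
  show "pmf (bind_pmf (kernel n nu) (kernel m)) la = pmf (bind_pmf (kernel m nu) (kernel n)) la"
  proof (cases "la \<in> Sig k")
    case False
    have "la \<notin> set_pmf (bind_pmf (kernel i nu) (kernel j))" for i j
      unfolding set_bind_pmf using False set_kernel[OF nu] set_kernel by blast
    then show ?thesis
      unfolding set_pmf_iff by simp
  next
    case la: True
    obtain lo N where W: "neg_sig nu \<in> window k lo N" "neg_sig la \<in> window k lo N"
      using ex_window[of "{neg_sig nu, neg_sig la}" k] neg_sig_Sig[OF nu] neg_sig_Sig[OF la] by auto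
    define C where "C n = (1 - t ^ n) / (1 - t ^ (n + k))" for n
    have eq: "pmf (bind_pmf (kernel i nu) (kernel j)) la = C i * C j * t powi (nstat (neg_sig la) - nstat (neg_sig nu)) *
        (\<Sum>b\<in>window k lo N. strip_weight k t (t ^ i) (neg_sig nu) b * strip_weight k t (t ^ j) b (neg_sig la))"
      if i: "1 \<le> i" and j: "1 \<le> j" for i j
    proof -
      have "pmf (bind_pmf (kernel i nu) (kernel j)) la
          = (\<Sum>b\<in>window k lo N. pmf (kernel i nu) (neg_sig b) * cotrans k t j (neg_sig b) la)"
      proof (rule pmf_bind_kernel[OF set_kernel[OF nu] j la W(2,1)])
        fix b r assume b: "b \<in> set_pmf (kernel i nu)" and r: "r < k"
        then have bS: "b \<in> Sig k"
          using set_kernel[OF nu] by auto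
        have "cotrans k t i nu b \<noteq> 0"
          using b pmf_kernel[OF i nu bS] by (simp add: set_pmf_iff)
        then show "neg_sig nu ! r \<le> neg_sig b ! r"
          using cotrans_nonzero_prec[OF i nu bS] r by (simp add: prec_Q_nth)
      qed
      also have "\<dots> = (\<Sum>b\<in>window k lo N. C i * C j * t powi (nstat (neg_sig la) - nstat (neg_sig nu)) *
          (strip_weight k t (t ^ i) (neg_sig nu) b * strip_weight k t (t ^ j) b (neg_sig la)))"
      proof (rule sum.cong[OF refl])
        fix b assume "b \<in> window k lo N"
        then have b: "neg_sig b \<in> Sig k"
          by (simp add: neg_sig_Sig window_Sig)
        have "t powi (nstat (neg_sig la) - nstat (neg_sig nu))
            = t powi (nstat b - nstat (neg_sig nu)) * t powi (nstat (neg_sig la) - nstat b)"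
          using t_pos by (simp add: power_int_add[symmetric])
        then show "pmf (kernel i nu) (neg_sig b) * cotrans k t j (neg_sig b) la
            = C i * C j * t powi (nstat (neg_sig la) - nstat (neg_sig nu)) *
          (strip_weight k t (t ^ i) (neg_sig nu) b * strip_weight k t (t ^ j) b (neg_sig la))"
          unfolding pmf_kernel[OF i nu b] cotrans_eq[OF i nu b] cotrans_eq[OF j b la] C_def
          by (simp only: neg_sig_neg_sig mult_ac)
      qed
      finally show ?thesis
        by (simp add: sum_distrib_left)
    qed
    show ?thesis
      unfolding eq[OF n m] eq[OF m n] strip_weight_commute[OF W, of t "t ^ n" "t ^ m"] by simp
  qed
qed

lemma set_descend: "nu \<in> Sig k \<Longrightarrow> set_pmf (descend n J nu) \<subseteq> Sig k"
proof (induction J arbitrary: nu)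
  case (Suc J)
  then show ?case
    using set_kernel[of nu "n + J"] by auto
qed simp

lemma descend_kernel_commute:
  assumes n: "1 \<le> n" and m: "1 \<le> m"
  shows "nu \<in> Sig k \<Longrightarrow> bind_pmf (descend n J nu) (kernel m) = bind_pmf (kernel m nu) (descend n J)"
proof (induction J arbitrary: nu)
  case 0
  then show ?case
    by (simp add: descend_0 bind_return_pmf bind_return_pmf')
next
  case (Suc J)
  have "bind_pmf (descend n (Suc J) nu) (kernel m)
      = bind_pmf (kernel (n + J) nu) (\<lambda>b. bind_pmf (descend n J b) (kernel m))"
    by (simp add: bind_assoc_pmf)
  also have "\<dots> = bind_pmf (kernel (n + J) nu) (\<lambda>b. bind_pmf (kernel m b) (descend n J))"
    by (rule bind_pmf_cong[OF refl], rule Suc.IH) (use set_kernel[OF Suc.prems] in blast)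
  also have "\<dots> = bind_pmf (bind_pmf (kernel (n + J) nu) (kernel m)) (descend n J)"
    by (simp only: bind_assoc_pmf)
  also have "bind_pmf (kernel (n + J) nu) (kernel m) = bind_pmf (kernel m nu) (kernel (n + J))"
    using n m Suc.prems by (intro kernel_commute) auto
  also have "bind_pmf (bind_pmf (kernel m nu) (kernel (n + J))) (descend n J) = bind_pmf (kernel m nu) (descend n (Suc J))"
    unfolding bind_assoc_pmf by (rule bind_pmf_cong[OF refl]) simp
  finally show ?case .
qed

text \<open>In \<open>descend n J\<close> the step with parameter \<open>t ^ n\<close> comes last, whereas in
  \<open>hl_Q\<close> it comes first; commutation of the kernels reconciles the two orders.\<close>

lemma descend_Suc_last:
  assumes "1 \<le> n" "nu \<in> Sig k"
  shows "descend n (Suc J) nu = bind_pmf (descend n J nu) (kernel (n + J))"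
  using descend_kernel_commute[of n "n + J" nu J] assms by simp

text \<open>Both sides are extended by the variable \<open>t ^ (n + J)\<close> at the end; the
  intermediate P-values cancel and the Cauchy factors multiply.\<close>

lemma pmf_descend:
  assumes n: "1 \<le> n" and mu: "mu \<in> Sig k" and la: "la \<in> Sig k"
  shows "pmf (descend n J mu) la = hl_Q k t (neg_sig la) (neg_sig mu) J (\<lambda>j. t ^ (n + j)) *
    (P (neg_sig la) / (P (neg_sig mu) * Pi_fin t k (\<lambda>i. t ^ i) J (\<lambda>j. t ^ (n + j))))"
  using la
proof (induction J arbitrary: la)
  case 0
  have "neg_sig la = neg_sig mu \<longleftrightarrow> la = mu"
    by (metis neg_sig_neg_sig)
  then show ?case
    using P_pos[OF neg_sig_Sig[OF mu]]
    by (cases "la = mu") (simp_all add: hl_Q_0[OF neg_sig_Sig[OF mu]] Pi_fin_def)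
next
  case (Suc J)
  let ?y = "\<lambda>j. t ^ (n + j)"
  let ?Pi = "\<lambda>J. Pi_fin t k (\<lambda>i. t ^ i) J ?y"
  obtain lo N where W: "neg_sig mu \<in> window k lo N" "neg_sig la \<in> window k lo N"
    using ex_window[of "{neg_sig mu, neg_sig la}" k] neg_sig_Sig[OF mu] neg_sig_Sig[OF Suc.prems] by auto
  have nJ: "1 \<le> n + J"
    using n by simp
  have "pmf (descend n (Suc J) mu) la
      = (\<Sum>b\<in>window k lo N. pmf (descend n J mu) (neg_sig b) * cotrans k t (n + J) (neg_sig b) la)"
    unfolding descend_Suc_last[OF n mu]
  proof (rule pmf_bind_kernel[OF set_descend[OF mu] nJ Suc.prems W(2,1)])
    fix b i assume b: "b \<in> set_pmf (descend n J mu)" and i: "i < k"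
    then have "b \<in> Sig k"
      using set_descend[OF mu] by auto
    then have "hl_Q k t (neg_sig b) (neg_sig mu) J ?y \<noteq> 0"
      using b Suc.IH[of b] by (auto simp: set_pmf_iff)
    then show "neg_sig mu ! i \<le> neg_sig b ! i"
      using i by (rule hl_Q_nonzero_nth)
  qed
  also have "\<dots> = (\<Sum>b\<in>window k lo N. hl_Q k t b (neg_sig mu) J ?y * hl_Q k t (neg_sig la) b 1 (\<lambda>_. ?y J)) *
      (P (neg_sig la) / (P (neg_sig mu) * ?Pi (Suc J)))"
    unfolding sum_distrib_right
  proof (rule sum.cong[OF refl])
    fix b assume "b \<in> window k lo N"
    then have b: "b \<in> Sig k" "neg_sig b \<in> Sig k"
      by (simp_all add: neg_sig_Sig window_Sig)
    show "pmf (descend n J mu) (neg_sig b) * cotrans k t (n + J) (neg_sig b) la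
        = hl_Q k t b (neg_sig mu) J ?y * hl_Q k t (neg_sig la) b 1 (\<lambda>_. ?y J) *
          (P (neg_sig la) / (P (neg_sig mu) * ?Pi (Suc J)))"
      unfolding Suc.IH[OF b(2)] cotrans_def Pi_fin_Suc[of t k _ J] neg_sig_neg_sig
      using P_pos[OF b(1)] by simp
  qed
  also have "(\<Sum>b\<in>window k lo N. hl_Q k t b (neg_sig mu) J ?y * hl_Q k t (neg_sig la) b 1 (\<lambda>_. ?y J))
      = hl_Q k t (neg_sig la) (neg_sig mu) (Suc J) ?y"
  proof (rule hl_Q_Suc[symmetric])
    fix b c assume c: "c \<in> Q_chains k J b (neg_sig mu)" and b: "prec_Q k b (neg_sig la)"
    show "b \<in> window k lo N"
      by (rule window_between[OF W prec_Q_Sig(1)[OF b]]) (auto simp: Q_chains_nth_mono[OF c] prec_Q_nth[OF b])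
  qed (auto simp: finite_window neg_sig_Sig Suc.prems dest: window_Sig)
  finally show ?case .
qed

lemma pmf_entrance:
  assumes n: "1 \<le> n" and mu: "mu \<in> Sig k" and la: "la \<in> Sig k"
  shows "pmf (entrance mu n) la = hl_Q_inf k t (neg_sig la) (neg_sig mu) (\<lambda>j. t ^ (n + j)) *
    (P (neg_sig la) / (P (neg_sig mu) * Pi_inf t k (\<lambda>i. t ^ i) (\<lambda>j. t ^ (n + j))))"
proof -
  let ?Q = "\<lambda>J. hl_Q k t (neg_sig la) (neg_sig mu) J (\<lambda>j. t ^ (n + j))"
  let ?Pi = "\<lambda>J. Pi_fin t k (\<lambda>i. t ^ i) J (\<lambda>j. t ^ (n + j))"
  let ?Pinf = "Pi_inf t k (\<lambda>i. t ^ i) (\<lambda>j. t ^ (n + j))"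
  note PI = Pi_fin_tendsto_Pi_inf[OF t_pos t_less_1 n, of k]
  have pos: "P (neg_sig la) > 0" "P (neg_sig mu) > 0"
    using P_pos[OF neg_sig_Sig[OF la]] P_pos[OF neg_sig_Sig[OF mu]] by auto
  have "(\<lambda>J. pmf (descend n J mu) la * (P (neg_sig mu) * ?Pi J) / P (neg_sig la))
      \<longlonglongrightarrow> pmf (entrance mu n) la * (P (neg_sig mu) * ?Pinf) / P (neg_sig la)"
    using pos by (intro tendsto_intros descend_tendsto PI) auto
  \<comment> \<open>The positive limit makes the finite Cauchy factors nonzero from some J on, which
    is enough to solve for the finite Q.\<close>
  moreover have "\<forall>\<^sub>F J in sequentially. pmf (descend n J mu) la * (P (neg_sig mu) * ?Pi J) / P (neg_sig la) = ?Q J"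
    using order_tendstoD(1)[OF PI]
    by eventually_elim (use pos in \<open>simp add: pmf_descend[OF n mu la]\<close>)
  ultimately have "?Q \<longlonglongrightarrow> pmf (entrance mu n) la * (P (neg_sig mu) * ?Pinf) / P (neg_sig la)"
    by (rule Lim_transform_eventually)
  then have "hl_Q_inf k t (neg_sig la) (neg_sig mu) (\<lambda>j. t ^ (n + j))
      = pmf (entrance mu n) la * (P (neg_sig mu) * ?Pinf) / P (neg_sig la)"
    unfolding hl_Q_inf_def by (rule limI)
  then show ?thesis
    using pos PI(2) by simp
qed

end

theorem theorem5p7:
  fixes t :: real and k :: nat
  assumes "0 < t" and "t < 1" and "k \<ge> 1"
  shows "\<exists>M. bij_betw M (Sig k) (boundary k t) \<and>
    (\<forall>mu\<in>Sig k. \<forall>n\<ge>1. \<forall>la\<in>Sig k.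
       pmf (M mu n) la =
         hl_Q_inf k t (neg_sig la) (neg_sig mu) (\<lambda>j. t ^ (n + j)) *
         (hl_P k t (neg_sig la) (\<lambda>i. t ^ i) /
          (hl_P k t (neg_sig mu) (\<lambda>i. t ^ i) * Pi_inf t k (\<lambda>i. t ^ i) (\<lambda>j. t ^ (n + j)))))"
proof -
  interpret hl_graph k t
    by standard (use assms in auto)
  show ?thesis
  proof (intro exI conjI ballI allI impI)
    show "bij_betw (\<lambda>mu. restrict (entrance mu) {1..}) (Sig k) (boundary k t)"
      unfolding boundary_eq by (rule bij_betw_extreme_systems) (rule set_kernel)
    fix mu la and n :: nat
    assume "mu \<in> Sig k" "1 \<le> n" "la \<in> Sig k"
    then show "pmf (restrict (entrance mu) {1..} n) la =
         hl_Q_inf k t (neg_sig la) (neg_sig mu) (\<lambda>j. t ^ (n + j)) *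
         (hl_P k t (neg_sig la) (\<lambda>i. t ^ i) /
          (hl_P k t (neg_sig mu) (\<lambda>i. t ^ i) * Pi_inf t k (\<lambda>i. t ^ i) (\<lambda>j. t ^ (n + j))))"
      by (simp add: pmf_entrance)
  qed
qed

end
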